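(* Let $f,g,c$ satisfy the standing assumption on the composite problem (P), $\min_x\Phi(x)=f(x)+g(c(x))$, and suppose that (P) possesses a stationary minimizer. Let $\{(x^k,z^k,y^k,\hat y^k)\}$ be a sequence generated by the safeguarded augmented Lagrangian method (described in the context) such that $\sum_{k=0}^\infty\sqrt{\varepsilon_k/\mu_k}<\infty$. Let $\mu\ge0$ be the limit of the nonincreasing sequence $\{\mu_k\}$. Then $\{y^k\}$ is bounded and the following hold: (i) If $\mu=0$, then each accumulation point of $\{y^k\}$ belongs to $\Lambda$. (ii) If $\mu>0$, then $\{y^k\}$ converges to a solution of the problem $\text{minimize}_{y\in\mathbb R^m}\ -d(y)+\frac\mu2\operatorname{dist}_S^2(y)$, where $d$ is the Lagrange dual function of (P). (iii) If $\Lambda\cap S\ne\emptyset$, then $\{y^k\}$ converges to an element of $\Lambda\cap S$.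
   Context: Spaces $\mathbb R^n,\mathbb R^m$ carry the Euclidean inner product $\langle\cdot,\cdot\rangle$ and norm $\|\cdot\|$; $\overline{\mathbb R}=\mathbb R\cup\{+\infty\}$. For a proper lsc convex $g:\mathbb R^m\to\overline{\mathbb R}$, the horizon is $\operatorname{hzn} g=\{v\in\mathbb R^m : g(z+v)\le g(z)\ \forall z\in\operatorname{dom} g\}$ and $g^*$ is the convex conjugate. Standing assumption: $f:\mathbb R^n\to\mathbb R$ is continuously differentiable and convex; $g:\mathbb R^m\to\overline{\mathbb R}$ is proper, lsc, convex; $c:\mathbb R^n\to\mathbb R^m$ is continuously differentiable and $(-\operatorname{hzn} g)$-convex, i.e. $c(\lambda x+(1-\lambda)x')-\lambda c(x)-(1-\lambda)c(x')\in\operatorname{hzn} g$ for all $x,x'\in\mathbb R^n$, $\lambda\in[0,1]$; (P) is feasible and possesses a minimizer. A feasible point $\bar x$ is stationary if there is $\bar y\in\partial g(c(\bar x))$ with $\nabla f(\bar x)+c'(\bar x)^\top\bar y=0$; the set of all such $\bar y$ (multipliers) is $\Lambda(\bar x)$. If (P) has a stationary minimizer, all minimizers of (P) are stationary and share the same multiplier set, denoted $\Lambda$. Lagrangian: $L(x,y)=f(x)+\langle y,c(x)\rangle-g^*(y)$. Dual function: $d(y)=\inf_xL(x,y)\in\mathbb R\cup\{-\infty\}$. Augmented Lagrangian for $\mu>0$: $L_\mu(x,y)=f(x)+g^\mu(c(x)+\mu y)-\frac\mu2\|y\|^2$, where $g^\mu(z)=\inf_w\{g(w)+\frac1{2\mu}\|w-z\|^2\}$.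 $\operatorname{prox}_\varphi(z)$ is the unique minimizer of $w\mapsto\varphi(w)+\frac12\|w-z\|^2$; $\operatorname{proj}_S$ and $\operatorname{dist}_S$ are the Euclidean projection onto and distance to $S$. Safeguarded ALM. Data: $y^0\in\mathbb R^m$; $\mu_0>0$; nonempty, convex, compact set $S\subseteq\mathbb R^m$; $\beta\in(0,1)$. For $k=0,1,2,\dots$: set $\hat y^k=\operatorname{proj}_S(y^k)$; select $\varepsilon_k\ge0$ and $x^k\in\mathbb R^n$ with $L_{\mu_k}(x^k,\hat y^k)\le\inf_xL_{\mu_k}(x,\hat y^k)+\varepsilon_k$; set $z^k=\operatorname{prox}_{\mu_kg}(c(x^k)+\mu_k\hat y^k)$; set $y^{k+1}=\hat y^k+\mu_k^{-1}(c(x^k)-z^k)$; set $\mu_{k+1}=\beta_k\mu_k$ for some $\beta_k\in(0,\beta]\cup\{1\}$. *)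

theory Defs
  imports "HOL-Analysis.Analysis"
begin

section \<open>Extended-real-valued convex functions\<close>

definition edom :: "('a \<Rightarrow> ereal) \<Rightarrow> 'a set" where
  "edom \<phi> = {z. \<phi> z < \<infinity>}"

definition proper :: "('a \<Rightarrow> ereal) \<Rightarrow> bool" where
  "proper \<phi> \<longleftrightarrow> (\<forall>z. \<phi> z \<noteq> -\<infinity>) \<and> edom \<phi> \<noteq> {}"

definition lsc :: "('a::topological_space \<Rightarrow> ereal) \<Rightarrow> bool" where
  "lsc \<phi> \<longleftrightarrow> (\<forall>z. \<phi> z \<le> Liminf (at z) \<phi>)"

text \<open>Only used for functions that never take the value \<open>-\<infinity>\<close>, so the sum on the right is
  never of the form \<open>\<infinity> - \<infinity>\<close>; at \<open>t = 0\<close> and \<open>t = 1\<close> the convention \<open>0 * \<infinity> = 0\<close> applies.\<close>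

definition econvex :: "('a::real_vector \<Rightarrow> ereal) \<Rightarrow> bool" where
  "econvex \<phi> \<longleftrightarrow>
     (\<forall>z w. \<forall>t\<in>{0..1}. \<phi> (t *\<^sub>R z + (1 - t) *\<^sub>R w) \<le> ereal t * \<phi> z + ereal (1 - t) * \<phi> w)"

definition hzn :: "('a::real_vector \<Rightarrow> ereal) \<Rightarrow> 'a set" where
  "hzn \<phi> = {v. \<forall>z\<in>edom \<phi>. \<phi> (z + v) \<le> \<phi> z}"

definition conjugate :: "('a::real_inner \<Rightarrow> ereal) \<Rightarrow> 'a \<Rightarrow> ereal" where
  "conjugate \<phi> y = (SUP z. ereal (y \<bullet> z) - \<phi> z)"

definition subdifferential :: "('a::real_inner \<Rightarrow> ereal) \<Rightarrow> 'a \<Rightarrow> 'a set" where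
  "subdifferential \<phi> z =
     (if z \<in> edom \<phi> then {y. \<forall>w. \<phi> z + ereal (y \<bullet> (w - z)) \<le> \<phi> w} else {})"

definition moreau_envelope :: "real \<Rightarrow> ('a::real_normed_vector \<Rightarrow> ereal) \<Rightarrow> 'a \<Rightarrow> ereal" where
  "moreau_envelope \<mu> \<phi> z = (INF w. \<phi> w + ereal (1 / (2 * \<mu>) * (norm (w - z))\<^sup>2))"

text \<open>Minimizers are required to have a value below \<open>\<infinity>\<close>, that is, to be feasible.\<close>

definition is_minimizer :: "('a \<Rightarrow> ereal) \<Rightarrow> 'a \<Rightarrow> bool" where
  "is_minimizer \<phi> x \<longleftrightarrow> x \<in> edom \<phi> \<and> (\<forall>x'. \<phi> x \<le> \<phi> x')"

definition prox :: "('a::real_normed_vector \<Rightarrow> ereal) \<Rightarrow> 'a \<Rightarrow> 'a" where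
  "prox \<phi> z = (THE w. is_minimizer (\<lambda>w. \<phi> w + ereal (1 / 2 * (norm (w - z))\<^sup>2)) w)"


section \<open>The composite problem\<close>

definition objective ::
    "('a \<Rightarrow> real) \<Rightarrow> ('b \<Rightarrow> ereal) \<Rightarrow> ('a \<Rightarrow> 'b) \<Rightarrow> 'a \<Rightarrow> ereal" where
  "objective f g c x = ereal (f x) + g (c x)"

text \<open>The assumptions on the data; \<open>gradf\<close> is the gradient of \<open>f\<close> and \<open>J\<close> the Jacobian matrix of \<open>c\<close>.\<close>

definition composite_data ::
    "(real ^ 'n \<Rightarrow> real) \<Rightarrow> (real ^ 'm \<Rightarrow> ereal) \<Rightarrow> (real ^ 'n \<Rightarrow> real ^ 'm) \<Rightarrow>
     (real ^ 'n \<Rightarrow> real ^ 'n) \<Rightarrow> (real ^ 'n \<Rightarrow> real ^ 'n ^ 'm) \<Rightarrow> bool" where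
  "composite_data f g c gradf J \<longleftrightarrow>
     (\<forall>x. GDERIV f x :> gradf x) \<and> continuous_on UNIV gradf \<and> convex_on UNIV f \<and>
     proper g \<and> lsc g \<and> econvex g \<and>
     (\<forall>x. (c has_derivative (\<lambda>h. J x *v h)) (at x)) \<and> continuous_on UNIV J \<and>
     (\<forall>x x'. \<forall>t\<in>{0..1}.
        c (t *\<^sub>R x + (1 - t) *\<^sub>R x') - t *\<^sub>R c x - (1 - t) *\<^sub>R c x' \<in> hzn g)"

definition multipliers ::
    "(real ^ 'm \<Rightarrow> ereal) \<Rightarrow> (real ^ 'n \<Rightarrow> real ^ 'm) \<Rightarrow> (real ^ 'n \<Rightarrow> real ^ 'n) \<Rightarrow>
     (real ^ 'n \<Rightarrow> real ^ 'n ^ 'm) \<Rightarrow> real ^ 'n \<Rightarrow> (real ^ 'm) set" where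
  "multipliers g c gradf J x =
     {y \<in> subdifferential g (c x). gradf x + transpose (J x) *v y = 0}"

definition stationary ::
    "(real ^ 'm \<Rightarrow> ereal) \<Rightarrow> (real ^ 'n \<Rightarrow> real ^ 'm) \<Rightarrow> (real ^ 'n \<Rightarrow> real ^ 'n) \<Rightarrow>
     (real ^ 'n \<Rightarrow> real ^ 'n ^ 'm) \<Rightarrow> real ^ 'n \<Rightarrow> bool" where
  "stationary g c gradf J x \<longleftrightarrow> c x \<in> edom g \<and> multipliers g c gradf J x \<noteq> {}"

definition lagrangian ::
    "('a \<Rightarrow> real) \<Rightarrow> ('b::real_inner \<Rightarrow> ereal) \<Rightarrow> ('a \<Rightarrow> 'b) \<Rightarrow> 'a \<Rightarrow> 'b \<Rightarrow> ereal" where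
  "lagrangian f g c x y = ereal (f x) + ereal (y \<bullet> c x) - conjugate g y"

definition dual_function ::
    "('a \<Rightarrow> real) \<Rightarrow> ('b::real_inner \<Rightarrow> ereal) \<Rightarrow> ('a \<Rightarrow> 'b) \<Rightarrow> 'b \<Rightarrow> ereal" where
  "dual_function f g c y = (INF x. lagrangian f g c x y)"

definition aug_lagrangian ::
    "('a \<Rightarrow> real) \<Rightarrow> ('b::real_inner \<Rightarrow> ereal) \<Rightarrow> ('a \<Rightarrow> 'b) \<Rightarrow> real \<Rightarrow> 'a \<Rightarrow> 'b \<Rightarrow> ereal" where
  "aug_lagrangian f g c \<mu> x y =
     ereal (f x) + moreau_envelope \<mu> g (c x + \<mu> *\<^sub>R y) - ereal (\<mu> / 2 * (norm y)\<^sup>2)"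


section \<open>The safeguarded augmented Lagrangian method\<close>

text \<open>The starting point \<open>y 0\<close> is unrestricted; \<open>yh\<close> is the sequence of safeguarded multipliers
  and \<open>mu\<close> the sequence of penalty parameters.\<close>

definition safeguarded_ALM ::
    "('a \<Rightarrow> real) \<Rightarrow> ('b::euclidean_space \<Rightarrow> ereal) \<Rightarrow> ('a \<Rightarrow> 'b) \<Rightarrow> 'b set \<Rightarrow> real \<Rightarrow>
     (nat \<Rightarrow> real) \<Rightarrow> (nat \<Rightarrow> real) \<Rightarrow>
     (nat \<Rightarrow> 'a) \<Rightarrow> (nat \<Rightarrow> 'b) \<Rightarrow> (nat \<Rightarrow> 'b) \<Rightarrow> (nat \<Rightarrow> 'b) \<Rightarrow> bool" where
  "safeguarded_ALM f g c S \<beta> \<epsilon> mu x z y yh \<longleftrightarrow>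
     S \<noteq> {} \<and> convex S \<and> compact S \<and> 0 < \<beta> \<and> \<beta> < 1 \<and> 0 < mu 0 \<and>
     (\<forall>k. yh k = closest_point S (y k) \<and>
          0 \<le> \<epsilon> k \<and>
          aug_lagrangian f g c (mu k) (x k) (yh k)
            \<le> (INF x'. aug_lagrangian f g c (mu k) x' (yh k)) + ereal (\<epsilon> k) \<and>
          z k = prox (\<lambda>w. ereal (mu k) * g w) (c (x k) + mu k *\<^sub>R yh k) \<and>
          y (Suc k) = yh k + (1 / mu k) *\<^sub>R (c (x k) - z k) \<and>
          (\<exists>b \<in> {0<..\<beta>} \<union> {1}. mu (Suc k) = b * mu k))"

end

theory Submission
  imports Defs
begin

text \<open>
  Let \<open>h w = inf\<^sub>x f x + g (c x + w)\<close> be the perturbation function of the problem; it is convex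
  because \<open>c\<close> is \<open>(- hzn g)\<close>-convex. The multipliers are the subgradients of \<open>h\<close> at \<open>0\<close>, and
  \<open>inf\<^sub>x L\<^sub>\<mu>(x, v) = inf\<^sub>w h w + |w|\<^sup>2 / (2 \<mu>) - v \<bullet> w\<close>. The last objective is strongly convex, so
  the residual \<open>z\<^sup>k - c x\<^sup>k\<close> of an \<open>\<epsilon>\<close>-minimizer is within \<open>sqrt (2 \<mu> \<epsilon>)\<close> of the minimizer \<open>W\<close> of the
  closure of \<open>h\<close>, and \<open>y\<close> is updated, up to an error \<open>sqrt (2 \<epsilon> / \<mu>)\<close>, by the proximal map
  \<open>P v = v - W / \<mu>\<close> of the negative dual function. Both \<open>P\<close> and the projection onto \<open>S\<close> are firmly
  nonexpansive, so \<open>y\<close> is quasi-Fejer monotone with respect to the fixed points of their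
  composition. Such fixed points exist by Brouwer's theorem when \<open>\<mu> > 0\<close>, and they include
  \<open>\<Lambda> \<inter> S\<close>. Whenever \<open>W \<longlonglongrightarrow> 0\<close>, the accumulation points of \<open>y\<close> are multipliers.
\<close>

section \<open>Proximal steps described by epigraphs\<close>

text \<open>\<open>p\<close> is a subgradient at \<open>w\<close>, where the value is \<open>r\<close>, of the function with epigraph \<open>C\<close>. Thus
  \<open>epi_subgradient C p (\<mu> *\<^sub>R (v - p)) r\<close> says that \<open>p\<close> is the proximal point of \<open>v\<close> for the conjugate
  of that function divided by \<open>\<mu>\<close>.\<close>

definition epi_subgradient :: "('b::real_inner \<times> real) set \<Rightarrow> 'b \<Rightarrow> 'b \<Rightarrow> real \<Rightarrow> bool" where
  "epi_subgradient C p w r \<longleftrightarrow> (w, r) \<in> C \<and> (\<forall>(w', r')\<in>C. r + p \<bullet> (w' - w) \<le> r')"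

lemma epi_subgradientD:
  assumes "epi_subgradient C p w r" "(w', r') \<in> C"
  shows "r + p \<bullet> (w' - w) \<le> r'"
  using assms unfolding epi_subgradient_def by blast

text \<open>With \<open>p = v - (1 / \<mu>) *\<^sub>R w\<close>, adding the exact expansion of the
  square to the subgradient inequality leaves the term
  \<open>(norm (w' - w))\<^sup>2 / (2 * \<mu>)\<close> over. This strong convexity bound makes
  minimizers unique and later turns \<open>\<epsilon>\<close>-minimality into a distance.\<close>

lemma epi_subgradient_growth:
  assumes "epi_subgradient C p (\<mu> *\<^sub>R (v - p)) r" "(w', r') \<in> C" "0 < \<mu>"
  defines "w \<equiv> \<mu> *\<^sub>R (v - p)"
  shows "r + (norm w)\<^sup>2 / (2 * \<mu>) - v \<bullet> w + (norm (w' - w))\<^sup>2 / (2 * \<mu>)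
           \<le> r' + (norm w')\<^sup>2 / (2 * \<mu>) - v \<bullet> w'"
proof -
  have "p = v - (1 / \<mu>) *\<^sub>R w" using \<open>0 < \<mu>\<close> by (simp add: w_def)
  then have "r + (v - (1 / \<mu>) *\<^sub>R w) \<bullet> (w' - w) \<le> r'"
    using epi_subgradientD[OF assms(1,2)] unfolding w_def by metis
  moreover have "(norm (w' - w))\<^sup>2 / (2 * \<mu>) = (norm w')\<^sup>2 / (2 * \<mu>) - (norm w)\<^sup>2 / (2 * \<mu>) - (w \<bullet> (w' - w)) / \<mu>"
    using \<open>0 < \<mu>\<close> by (simp add: power2_norm_eq_inner inner_diff inner_commute field_simps)
  moreover have "(v - (1 / \<mu>) *\<^sub>R w) \<bullet> (w' - w) = v \<bullet> w' - v \<bullet> w - (w \<bullet> (w' - w)) / \<mu>"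
    by (simp add: inner_diff_left inner_diff_right[of v])
  ultimately show ?thesis by linarith
qed

lemma le_0_if_le_small_multiple:
  fixes a b :: real
  assumes "\<And>t. 0 < t \<Longrightarrow> t \<le> 1 \<Longrightarrow> 0 \<le> a + t * b"
  shows "0 \<le> a"
proof (rule tendsto_lowerbound)
  show "((\<lambda>t. a + t * b) \<longlongrightarrow> a) (at_right 0)"
    by (auto intro!: tendsto_eq_intros)
  show "\<forall>\<^sub>F t in at_right 0. 0 \<le> a + t * b"
    unfolding eventually_at_right_field using assms by (intro exI[of _ 1]) auto
qed auto

text \<open>The square dominates the affine minorant, so the sublevel set \<open>K\<close> of
  \<open>Q\<close> on the closed set \<open>C\<close> is compact and \<open>Q\<close> attains its
  minimum. First-order optimality along segments in the convex set \<open>C\<close> then gives the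
  subgradient inequality.\<close>

lemma epi_prox_exists:
  fixes C :: "('b::euclidean_space \<times> real) set"
  assumes "closed C" "convex C" "C \<noteq> {}" and minorant: "\<And>w r. (w, r) \<in> C \<Longrightarrow> a + q \<bullet> w \<le> r"
    and "0 < \<mu>"
  shows "\<exists>p r. epi_subgradient C p (\<mu> *\<^sub>R (v - p)) r"
proof -
  define Q where "Q = (\<lambda>(w, r). r + (norm w)\<^sup>2 / (2 * \<mu>) - v \<bullet> w)"
  have contQ: "continuous_on X Q" for X
    unfolding Q_def case_prod_beta by (intro continuous_intros) (use \<open>0 < \<mu>\<close> in auto)
  obtain w0 r0 where w0: "(w0, r0) \<in> C" using \<open>C \<noteq> {}\<close> by fast
  define q0 where "q0 = Q (w0, r0)"
  \<comment> \<open>In the sublevel set, \<open>norm w \<ge> 1\<close> forces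
    \<open>norm w \<le> B - 1\<close>. The added \<open>1\<close> gives \<open>B \<ge> 1\<close>, so
    for \<open>norm w > B\<close> the constant term may be multiplied by
    \<open>norm w\<close>.\<close>
  define B where "B = 2 * \<mu> * (norm (q - v) + \<bar>q0 - a\<bar>) + 1"
  have wB: "norm w \<le> B" if "(w, r) \<in> C" "Q (w, r) \<le> q0" for w r
  proof (rule ccontr)
    assume "\<not> norm w \<le> B"
    then have wB: "norm w > B" by simp
    have B1: "B \<ge> 1" using \<open>0 < \<mu>\<close> by (simp add: B_def)
    have "a + (q - v) \<bullet> w + (norm w)\<^sup>2 / (2 * \<mu>) \<le> q0"
      using minorant[OF that(1)] that(2) by (simp add: Q_def inner_diff)
    moreover have "- ((q - v) \<bullet> w) \<le> norm (q - v) * norm w"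
      using norm_cauchy_schwarz[of "- (q - v)" w] by (simp only: inner_minus_left norm_minus_cancel)
    ultimately have "(norm w)\<^sup>2 / (2 * \<mu>) \<le> \<bar>q0 - a\<bar> + norm (q - v) * norm w" by linarith
    also have "\<dots> \<le> \<bar>q0 - a\<bar> * norm w + norm (q - v) * norm w"
      using wB B1 mult_left_mono[of 1 "norm w" "\<bar>q0 - a\<bar>"] by simp
    finally have "(norm w)\<^sup>2 \<le> 2 * \<mu> * (\<bar>q0 - a\<bar> + norm (q - v)) * norm w"
      using \<open>0 < \<mu>\<close> by (simp add: field_simps)
    then have "norm w * norm w \<le> (B - 1) * norm w"
      by (simp add: B_def power2_eq_square algebra_simps)
    then show False using wB B1 by (simp add: mult_le_cancel_right)
  qed
  define K where "K = C \<inter> {u. Q u \<le> q0}"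
  \<comment> \<open>The height \<open>r\<close> is bounded below by the minorant and above by
    \<open>Q (w, r) \<le> q0\<close>, where the nonnegative square is dropped.\<close>
  have "K \<subseteq> cball 0 B \<times> {a - norm q * B .. q0 + norm v * B}"
  proof clarify
    fix w r assume K: "(w, r) \<in> K"
    then have C: "(w, r) \<in> C" and Q: "Q (w, r) \<le> q0" by (auto simp: K_def)
    have B: "norm w \<le> B" using wB C Q by blast
    have "- (q \<bullet> w) \<le> norm q * norm w" "v \<bullet> w \<le> norm v * norm w"
      using norm_cauchy_schwarz[of "- q" w] norm_cauchy_schwarz[of v w] by auto
    moreover have "norm q * norm w \<le> norm q * B" "norm v * norm w \<le> norm v * B"
      using B by (auto intro: mult_left_mono)
    moreover have "0 \<le> (norm w)\<^sup>2 / (2 * \<mu>)" using \<open>0 < \<mu>\<close> by simp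
    ultimately show "w \<in> cball 0 B \<and> r \<in> {a - norm q * B .. q0 + norm v * B}"
      using B minorant[OF C] Q by (simp add: Q_def)
  qed
  then have "bounded K"
    by (rule bounded_subset[rotated]) (intro bounded_Times bounded_cball bounded_closed_interval)
  moreover have "closed K"
    unfolding K_def using contQ by (intro closed_Int \<open>closed C\<close> closed_Collect_le) auto
  ultimately have "compact K" by (simp add: compact_eq_bounded_closed)
  moreover have "(w0, r0) \<in> K" by (simp add: K_def w0 q0_def)
  ultimately obtain u where u: "u \<in> K" "\<And>u'. u' \<in> K \<Longrightarrow> Q u \<le> Q u'"
    using continuous_attains_inf[of K Q] contQ by blast
  obtain w r where wr: "u = (w, r)" by fastforce
  have uC: "(w, r) \<in> C" using u wr by (auto simp: K_def)
  have min: "Q (w, r) \<le> Q (w', r')" if "(w', r') \<in> C" for w' r'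
  proof (cases "Q (w', r') \<le> q0")
    case True
    then show ?thesis using u(2)[of "(w', r')"] that wr by (auto simp: K_def)
  next
    case False
    then show ?thesis using u(1) wr by (auto simp: K_def)
  qed
  define p where "p = v - (1 / \<mu>) *\<^sub>R w"
  have "r + p \<bullet> (w' - w) \<le> r'" if C': "(w', r') \<in> C" for w' r'
  proof -
    \<comment> \<open>Minimality is tested at the point with parameter \<open>t\<close> of the
      segment towards \<open>(w', r')\<close> and divided by \<open>t\<close>; what remains of the
      quadratic remainder has order \<open>t\<close> and disappears as \<open>t\<close> tends to
      \<open>0\<close>.\<close>
    have "0 \<le> (r' - r - p \<bullet> (w' - w)) + t * ((norm (w' - w))\<^sup>2 / (2 * \<mu>))"
      if t: "0 < t" "t \<le> 1" for t
    proof -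
      have "(1 - t) *\<^sub>R (w, r) + t *\<^sub>R (w', r') \<in> C"
        using \<open>convex C\<close> uC C' t by (intro convexD) auto
      then have "(w + t *\<^sub>R (w' - w), r + t * (r' - r)) \<in> C"
        by (simp add: algebra_simps)
      from min[OF this] have "0 \<le> t * (r' - r) + (norm (w + t *\<^sub>R (w' - w)))\<^sup>2 / (2 * \<mu>)
            - (norm w)\<^sup>2 / (2 * \<mu>) - t * (v \<bullet> (w' - w))"
        by (simp add: Q_def inner_add_right)
      also have "(norm (w + t *\<^sub>R (w' - w)))\<^sup>2 = (norm w)\<^sup>2 + 2 * t * (w \<bullet> (w' - w)) + t\<^sup>2 * (norm (w' - w))\<^sup>2"
        unfolding power2_norm_eq_inner
        by (simp only: inner_add_left inner_add_right inner_scaleR_left inner_scaleR_right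
            inner_commute[of "w' - w" w] power2_eq_square) (simp add: algebra_simps)
      finally have "0 \<le> t * ((r' - r - p \<bullet> (w' - w)) + t * ((norm (w' - w))\<^sup>2 / (2 * \<mu>)))"
        unfolding p_def inner_diff_left inner_scaleR_left power2_eq_square[of t]
        by (simp only: add_divide_distrib) (simp add: algebra_simps diff_divide_distrib)
      then show ?thesis using t by (simp add: zero_le_mult_iff)
    qed
    from le_0_if_le_small_multiple[OF this] show ?thesis by simp
  qed
  moreover have "\<mu> *\<^sub>R (v - p) = w" using \<open>0 < \<mu>\<close> by (simp add: p_def)
  ultimately show ?thesis using uC unfolding epi_subgradient_def by (intro exI[of _ p] exI[of _ r]) auto
qed

section \<open>Firm nonexpansiveness of proximal maps and projections\<close>

lemma epi_subgradient_monotone: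
  assumes "epi_subgradient C p w r" "epi_subgradient C p' w' r'"
  shows "0 \<le> (p - p') \<bullet> (w - w')"
proof -
  have "r + p \<bullet> (w' - w) \<le> r'" "r' + p' \<bullet> (w - w') \<le> r"
    using assms by (auto simp: epi_subgradient_def)
  then show ?thesis by (simp add: inner_diff algebra_simps)
qed

text \<open>Expanding \<open>b = a + (b - a)\<close> leaves a nonnegative cross term. Both firmness
  estimates below reduce to this.\<close>

lemma power2_norm_split:
  fixes a b :: "'b::real_inner"
  assumes "0 \<le> a \<bullet> (b - a)"
  shows "(norm a)\<^sup>2 + (norm (b - a))\<^sup>2 \<le> (norm b)\<^sup>2"
  using assms by (simp add: power2_norm_eq_inner inner_diff inner_commute)

text \<open>Subgradients are monotone; inserting the residuals
  \<open>\<mu> *\<^sub>R (v - p)\<close> and cancelling \<open>\<mu>\<close> gives the inner product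
  condition of \<open>power2_norm_split\<close>.\<close>

lemma epi_prox_firm:
  assumes "epi_subgradient C p (\<mu> *\<^sub>R (v - p)) r" "epi_subgradient C p' (\<mu> *\<^sub>R (v' - p')) r'" "0 < \<mu>"
  shows "(norm (p - p'))\<^sup>2 + (norm ((v - p) - (v' - p')))\<^sup>2 \<le> (norm (v - v'))\<^sup>2"
proof -
  have "0 \<le> (p - p') \<bullet> (\<mu> *\<^sub>R ((v - v') - (p - p')))"
    using epi_subgradient_monotone[OF assms(1,2)] by (simp add: algebra_simps)
  then have "0 \<le> (p - p') \<bullet> ((v - v') - (p - p'))"
    using \<open>0 < \<mu>\<close> by (simp add: zero_le_mult_iff)
  from power2_norm_split[OF this] show ?thesis by (simp add: algebra_simps)
qed

lemma epi_prox_nonexpansive: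
  assumes "epi_subgradient C p (\<mu> *\<^sub>R (v - p)) r" "epi_subgradient C p' (\<mu> *\<^sub>R (v' - p')) r'" "0 < \<mu>"
  shows "norm (p - p') \<le> norm (v - v')"
proof (rule power2_le_imp_le)
  show "(norm (p - p'))\<^sup>2 \<le> (norm (v - v'))\<^sup>2"
    using epi_prox_firm[OF assms] zero_le_power2[of "norm ((v - p) - (v' - p'))"] by linarith
qed simp

text \<open>Sum of the obtuse angle inequalities at the two projections, each tested against the
  other projection.\<close>

lemma closest_point_firm:
  fixes S :: "'b::euclidean_space set"
  assumes "convex S" "closed S" "S \<noteq> {}"
  defines "\<pi> \<equiv> closest_point S"
  shows "(norm (\<pi> u - \<pi> v))\<^sup>2 + (norm ((u - \<pi> u) - (v - \<pi> v)))\<^sup>2 \<le> (norm (u - v))\<^sup>2"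
proof -
  have "\<pi> u \<in> S" "\<pi> v \<in> S" using assms by (auto simp: closest_point_in_set)
  then have "(u - \<pi> u) \<bullet> (\<pi> v - \<pi> u) \<le> 0" "(v - \<pi> v) \<bullet> (\<pi> u - \<pi> v) \<le> 0"
    unfolding \<pi>_def using closest_point_dot[OF assms(1,2)] by auto
  then have "0 \<le> (\<pi> u - \<pi> v) \<bullet> ((u - v) - (\<pi> u - \<pi> v))"
    by (simp add: inner_diff inner_commute algebra_simps)
  from power2_norm_split[OF this] show ?thesis by (simp add: algebra_simps)
qed

text \<open>Subtracting the accumulated errors makes the sequence decreasing from index
  \<open>K\<close> on; it stays bounded below by \<open>- suminf \<delta>\<close>.\<close>

lemma quasi_Fejer_convergent:
  fixes a \<delta> :: "nat \<Rightarrow> real"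
  assumes "\<And>k. K \<le> k \<Longrightarrow> a (Suc k) \<le> a k + \<delta> k" "\<And>k. 0 \<le> a k" "\<And>k. 0 \<le> \<delta> k" "summable \<delta>"
  shows "convergent a"
proof -
  define b where "b k = a (k + K) - (\<Sum>i<k + K. \<delta> i)" for k
  have "b (Suc k) \<le> b k" for k
    using assms(1)[of "k + K"] by (simp add: b_def)
  then have "decseq b" by (rule decseq_SucI)
  moreover have "- suminf \<delta> \<le> b k" for k
    using sum_le_suminf[of \<delta> "{..<k + K}"] assms(2)[of "k + K"] assms(3,4) by (simp add: b_def)
  ultimately obtain L where "b \<longlonglongrightarrow> L"
    using decseq_convergent by metis
  moreover have "(\<lambda>k. \<Sum>i<k + K. \<delta> i) \<longlonglongrightarrow> suminf \<delta>"
    using assms(4) by (intro LIMSEQ_ignore_initial_segment summable_LIMSEQ)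
  ultimately have "(\<lambda>k. b k + (\<Sum>i<k + K. \<delta> i)) \<longlonglongrightarrow> L + suminf \<delta>" by (rule tendsto_add)
  then have "(\<lambda>k. a (k + K)) \<longlonglongrightarrow> L + suminf \<delta>" by (simp add: b_def)
  then show ?thesis unfolding convergent_def using LIMSEQ_offset by blast
qed

text \<open>The tangent inequality for the squared distance, whose gradient at \<open>l\<close> is
  twice \<open>l - closest_point S l\<close>. Expand \<open>v - t\<close> around
  \<open>l - s\<close>, drop the last square, and use the obtuse angle at \<open>s\<close>.\<close>

lemma power2_norm_infdist_above_tangent:
  fixes S :: "'b::euclidean_space set"
  assumes "convex S" "closed S" "S \<noteq> {}"
  shows "(infdist l S)\<^sup>2 + 2 * ((l - closest_point S l) \<bullet> (v - l)) \<le> (infdist v S)\<^sup>2"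
proof -
  define s t where "s = closest_point S l" and "t = closest_point S v"
  have inf: "infdist u S = norm (u - closest_point S u)" for u
  proof (rule antisym)
    show "infdist u S \<le> norm (u - closest_point S u)"
      using infdist_le[OF closest_point_in_set[OF assms(2,3)]] by (metis dist_norm)
    show "norm (u - closest_point S u) \<le> infdist u S"
      unfolding infdist_notempty[OF assms(3)]
      using assms closest_point_le by (intro cINF_greatest) (auto simp flip: dist_norm)
  qed
  have "(l - s) \<bullet> (t - s) \<le> 0"
    unfolding s_def using closest_point_dot assms by (metis closest_point_in_set t_def)
  moreover have "(norm (v - t))\<^sup>2 = (norm (l - s))\<^sup>2 + 2 * ((l - s) \<bullet> ((v - l) - (t - s))) + (norm ((v - l) - (t - s)))\<^sup>2"
    by (simp add: power2_norm_eq_inner inner_diff inner_commute algebra_simps)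
  ultimately show ?thesis
    unfolding inf s_def[symmetric] t_def[symmetric]
    using zero_le_power2[of "norm ((v - l) - (t - s))"]
      inner_diff_right[of "l - s" "v - l" "t - s"] by linarith
qed

text \<open>Membership passes to the limit because \<open>C\<close> is closed, and each subgradient
  inequality because it is non-strict and continuous in the three sequences.\<close>

lemma epi_subgradient_limit:
  assumes "closed C" and sub: "\<And>k. epi_subgradient C (p k) (w k) (r k)"
    and "p \<longlonglongrightarrow> p'" "w \<longlonglongrightarrow> w'" "r \<longlonglongrightarrow> r'"
  shows "epi_subgradient C p' w' r'"
  unfolding epi_subgradient_def
proof (intro conjI; clarify?)
  have "(\<lambda>k. (w k, r k)) \<longlonglongrightarrow> (w', r')" by (intro tendsto_Pair assms)
  then show "(w', r') \<in> C"
    by (rule closed_sequentially[OF \<open>closed C\<close>, rotated]) (use sub in \<open>auto simp: epi_subgradient_def\<close>)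
next
  fix u s assume "(u, s) \<in> C"
  then have "r k + p k \<bullet> (u - w k) \<le> s" for k using epi_subgradientD[OF sub] by blast
  moreover have "(\<lambda>k. r k + p k \<bullet> (u - w k)) \<longlonglongrightarrow> r' + p' \<bullet> (u - w')"
    by (intro tendsto_intros assms)
  ultimately show "r' + p' \<bullet> (u - w') \<le> s"
    by (intro LIMSEQ_le_const2) auto
qed

section \<open>Safeguarded inexact proximal iterations\<close>

text \<open>The method seen in the space of multipliers: \<open>C\<close> stands for the closed
  epigraph of the perturbation function, \<open>a\<close> for the optimal value, \<open>q\<close>
  for a multiplier, \<open>p k\<close> for the exact proximal step from the safeguarded point, and
  \<open>y (Suc k)\<close> for its inexact version.\<close>

locale safeguarded_prox =
  fixes C :: "('b::euclidean_space \<times> real) set" and a :: real and S :: "'b set"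
    and mu \<delta> \<rho> :: "nat \<Rightarrow> real" and y p :: "nat \<Rightarrow> 'b" and q :: 'b
  assumes C: "closed C" "convex C"
    and S: "S \<noteq> {}" "convex S" "compact S"
    and multiplier: "epi_subgradient C q 0 a"
    and mu_pos: "0 < mu k"
    and prox: "epi_subgradient C (p k) (mu k *\<^sub>R (closest_point S (y k) - p k)) (\<rho> k)"
    and inexact: "norm (y (Suc k) - p k) \<le> \<delta> k"
    and summable_\<delta>: "summable \<delta>"
begin

abbreviation \<pi> where "\<pi> \<equiv> closest_point S"

lemma closed_S: "closed S" by (rule compact_imp_closed[OF S(3)])

lemma \<delta>_nonneg: "0 \<le> \<delta> k"
  by (rule order_trans[OF norm_ge_zero inexact])

lemma y_minus_p_tendsto: "(\<lambda>k. y (Suc k) - p k) \<longlonglongrightarrow> 0"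
  by (rule Lim_null_comparison[OF always_eventually[OF allI[OF inexact]] summable_LIMSEQ_zero[OF summable_\<delta>]])

text \<open>A subgradient at \<open>0\<close> is its own proximal point for every penalty parameter,
  since its residual \<open>u - u\<close> vanishes.\<close>

lemma prox_multiplier_bound:
  assumes "epi_subgradient C u 0 b"
  shows "norm (p k - u) \<le> norm (\<pi> (y k) - u)"
proof -
  have "epi_subgradient C u (mu k *\<^sub>R (u - u)) b" using assms by simp
  from epi_prox_nonexpansive[OF prox this mu_pos] show ?thesis .
qed

lemma bounded_proj: "bounded (range (\<lambda>k. \<pi> (y k)))"
proof -
  have "range (\<lambda>k. \<pi> (y k)) \<subseteq> S" using closest_point_in_set[OF closed_S S(1)] by auto
  then show ?thesis by (rule bounded_subset[OF compact_imp_bounded[OF S(3)]])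
qed

lemma bounded_p: "bounded (range p)"
proof -
  obtain B where B: "\<And>k. norm (\<pi> (y k)) \<le> B"
    using bounded_proj unfolding bounded_iff by blast
  have "norm (p k) \<le> B + norm q + norm q" for k
    using prox_multiplier_bound[OF multiplier, of k] B[of k] norm_triangle_ineq4[of "\<pi> (y k)" q]
      norm_triangle_sub[of "p k" q] by linarith
  then show ?thesis unfolding bounded_iff by blast
qed

lemma bounded_y: "bounded (range y)"
proof -
  have "bounded (range (\<lambda>k. y (Suc k) - p k))"
    by (rule convergent_imp_bounded[OF y_minus_p_tendsto])
  then have "bounded (range (\<lambda>k. (y (Suc k) - p k) + p k))"
    using bounded_p by (rule bounded_plus_comp)
  \<comment> \<open>The error bound only concerns successors, so the arbitrary start
    \<open>y 0\<close> is added by hand.\<close>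
  then have "bounded (insert (y 0) (range (\<lambda>k. y (Suc k))))" by simp
  moreover have "range y \<subseteq> insert (y 0) (range (\<lambda>k. y (Suc k)))"
  proof clarify
    fix k assume "y k \<notin> range (\<lambda>k. y (Suc k))"
    then show "y k = y 0" by (cases k) auto
  qed
  ultimately show ?thesis by (rule bounded_subset)
qed

text \<open>Along the subsequence the exact steps \<open>p\<close> also tend to \<open>l\<close> and
  the residuals \<open>w\<close> tend to \<open>0\<close>. Once the values \<open>\<rho>\<close> are
  shown to tend to \<open>a\<close>, closedness of the subgradient graph applies.\<close>

lemma accumulation_multiplier:
  assumes w: "(\<lambda>k. mu k *\<^sub>R (\<pi> (y k) - p k)) \<longlonglongrightarrow> 0"
    and "strict_mono r" and "(y \<circ> r) \<longlonglongrightarrow> l"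
  shows "epi_subgradient C l 0 a"
proof -
  define w where "w k = mu k *\<^sub>R (\<pi> (y k) - p k)" for k
  \<comment> \<open>The iterate with index \<open>r n\<close> is produced by the proximal step with
    index \<open>r n - 1\<close>; starting at \<open>Suc n\<close> keeps this subtraction from
    truncating.\<close>
  define j where "j n = r (Suc n) - 1" for n
  have rj: "r (Suc n) = Suc (j n)" for n
    using seq_suble[OF \<open>strict_mono r\<close>, of "Suc n"] by (simp add: j_def)
  have j: "filterlim j sequentially sequentially"
  proof (rule filterlim_at_top_mono[OF filterlim_ident])
    have "n \<le> j n" for n
      using seq_suble[OF \<open>strict_mono r\<close>, of "Suc n"] by (simp add: rj)
    then show "\<forall>\<^sub>F n in sequentially. n \<le> j n" by simp
  qed
  have "(\<lambda>n. y (Suc (j n))) \<longlonglongrightarrow> l"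
    using LIMSEQ_Suc[OF \<open>(y \<circ> r) \<longlonglongrightarrow> l\<close>] by (simp add: rj)
  moreover have "(\<lambda>n. y (Suc (j n)) - p (j n)) \<longlonglongrightarrow> 0"
    using filterlim_compose[OF y_minus_p_tendsto j] .
  ultimately have "(\<lambda>n. y (Suc (j n)) - (y (Suc (j n)) - p (j n))) \<longlonglongrightarrow> l - 0"
    by (rule tendsto_diff)
  then have p_l: "(\<lambda>n. p (j n)) \<longlonglongrightarrow> l" by simp
  have w0: "w \<longlonglongrightarrow> 0" using w unfolding w_def[abs_def] .
  then have wj: "(\<lambda>n. w (j n)) \<longlonglongrightarrow> 0" by (rule filterlim_compose[OF _ j])
  have sub: "epi_subgradient C (p k) (w k) (\<rho> k)" for k
    using prox unfolding w_def .
  \<comment> \<open>The values are squeezed by testing \<open>q\<close> at the point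
    \<open>w k\<close> and, next, \<open>p k\<close> at the point \<open>0\<close>. Both bounds tend
    to \<open>a\<close>.\<close>
  have lower: "a + q \<bullet> w k \<le> \<rho> k" for k
    using epi_subgradientD[OF multiplier, of "w k" "\<rho> k"] sub by (auto simp: epi_subgradient_def)
  have upper: "\<rho> k \<le> a + p k \<bullet> w k" for k
    using epi_subgradientD[OF sub, of 0 a k] multiplier by (simp add: epi_subgradient_def algebra_simps)
  have "(\<lambda>n. a + q \<bullet> w (j n)) \<longlonglongrightarrow> a + q \<bullet> 0" "(\<lambda>n. a + p (j n) \<bullet> w (j n)) \<longlonglongrightarrow> a + l \<bullet> 0"
    by (intro tendsto_intros wj p_l)+
  then have "(\<lambda>n. a + q \<bullet> w (j n)) \<longlonglongrightarrow> a" "(\<lambda>n. a + p (j n) \<bullet> w (j n)) \<longlonglongrightarrow> a" by simp_all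
  then have "(\<lambda>n. \<rho> (j n)) \<longlonglongrightarrow> a"
    by (rule real_tendsto_sandwich[rotated 2]) (simp_all add: lower upper)
  from epi_subgradient_limit[OF C(1) sub p_l wj this] show ?thesis .
qed

text \<open>Here \<open>u\<close> is fixed by the projection followed by the proximal map, at least
  from index \<open>K\<close> on. Adding the two firmness estimates bounds the deviations of both
  displacements from those at \<open>u\<close> by the decrease of the squared distance to
  \<open>u\<close>, which tends to \<open>0\<close>.\<close>

lemma Fejer:
  assumes u: "\<And>k. K \<le> k \<Longrightarrow> epi_subgradient C u (mu k *\<^sub>R (\<pi> u - u)) b"
  shows "convergent (\<lambda>k. norm (y k - u))"
    and "(\<lambda>k. y k - \<pi> (y k)) \<longlonglongrightarrow> u - \<pi> u"
    and "(\<lambda>k. \<pi> (y k) - p k) \<longlonglongrightarrow> \<pi> u - u"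
proof -
  define A where "A k = (y k - \<pi> (y k)) - (u - \<pi> u)" for k
  define B where "B k = (\<pi> (y k) - p k) - (\<pi> u - u)" for k
  have A: "(norm (\<pi> (y k) - \<pi> u))\<^sup>2 + (norm (A k))\<^sup>2 \<le> (norm (y k - u))\<^sup>2" for k
    unfolding A_def by (rule closest_point_firm[OF S(2) closed_S S(1)])
  have B: "(norm (p k - u))\<^sup>2 + (norm (B k))\<^sup>2 \<le> (norm (\<pi> (y k) - \<pi> u))\<^sup>2" if "K \<le> k" for k
    unfolding B_def by (rule epi_prox_firm[OF prox u[OF that] mu_pos])
  have AB: "(norm (A k))\<^sup>2 + (norm (B k))\<^sup>2 \<le> (norm (y k - u))\<^sup>2 - (norm (p k - u))\<^sup>2" if "K \<le> k" for k
    using A[of k] B[OF that] by linarith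
  have "norm (y (Suc k) - u) \<le> norm (y k - u) + \<delta> k" if "K \<le> k" for k
  proof -
    have "(norm (p k - u))\<^sup>2 \<le> (norm (y k - u))\<^sup>2"
      using AB[OF that] zero_le_power2[of "norm (A k)"] zero_le_power2[of "norm (B k)"] by linarith
    then have "norm (p k - u) \<le> norm (y k - u)" by simp
    then show ?thesis
      using inexact[of k] norm_triangle_ineq[of "y (Suc k) - p k" "p k - u"] by simp
  qed
  then show conv: "convergent (\<lambda>k. norm (y k - u))"
    by (rule quasi_Fejer_convergent) (auto simp: \<delta>_nonneg summable_\<delta>)
  then obtain L where L: "(\<lambda>k. norm (y k - u)) \<longlonglongrightarrow> L" by (auto simp: convergent_def)
  \<comment> \<open>The inexactness vanishes, so \<open>norm (p k - u)\<close> has the same limit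
    \<open>L\<close> as the distances of the iterates; hence the right-hand side of
    \<open>AB\<close> tends to \<open>0\<close>.\<close>
  have "(\<lambda>k. norm (y (Suc k) - u) - norm (p k - u)) \<longlonglongrightarrow> 0"
  proof (rule Lim_null_comparison)
    show "\<forall>\<^sub>F k in sequentially. norm (norm (y (Suc k) - u) - norm (p k - u)) \<le> norm (y (Suc k) - p k)"
      using norm_triangle_ineq3[of "y (Suc k) - u" "p k - u" for k] by simp
  qed (use tendsto_norm[OF y_minus_p_tendsto] in simp)
  from tendsto_diff[OF LIMSEQ_Suc[OF L] this] have pL: "(\<lambda>k. norm (p k - u)) \<longlonglongrightarrow> L" by simp
  have "(\<lambda>k. (norm (y k - u))\<^sup>2 - (norm (p k - u))\<^sup>2) \<longlonglongrightarrow> L\<^sup>2 - L\<^sup>2"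
    by (intro tendsto_intros L pL)
  then have gap: "(\<lambda>k. (norm (y k - u))\<^sup>2 - (norm (p k - u))\<^sup>2) \<longlonglongrightarrow> 0" by simp
  have null: "X \<longlonglongrightarrow> 0" if "\<And>k. K \<le> k \<Longrightarrow> (norm (X k))\<^sup>2 \<le> (norm (y k - u))\<^sup>2 - (norm (p k - u))\<^sup>2"
    for X :: "nat \<Rightarrow> 'b"
  proof -
    have "(\<lambda>k. (norm (X k))\<^sup>2) \<longlonglongrightarrow> 0"
      using gap by (rule Lim_null_comparison[rotated]) (use that in \<open>auto simp: eventually_sequentially\<close>)
    then have "(\<lambda>k. sqrt ((norm (X k))\<^sup>2)) \<longlonglongrightarrow> sqrt 0" by (rule tendsto_real_sqrt)
    then show ?thesis by (simp add: tendsto_norm_zero_iff)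
  qed
  have AB': "(norm (A k))\<^sup>2 \<le> (norm (y k - u))\<^sup>2 - (norm (p k - u))\<^sup>2"
    "(norm (B k))\<^sup>2 \<le> (norm (y k - u))\<^sup>2 - (norm (p k - u))\<^sup>2" if "K \<le> k" for k
    using AB[OF that] zero_le_power2[of "norm (A k)"] zero_le_power2[of "norm (B k)"] by linarith+
  have "A \<longlonglongrightarrow> 0" by (rule null) (rule AB'(1))
  moreover have "B \<longlonglongrightarrow> 0" by (rule null) (rule AB'(2))
  ultimately show "(\<lambda>k. y k - \<pi> (y k)) \<longlonglongrightarrow> u - \<pi> u" "(\<lambda>k. \<pi> (y k) - p k) \<longlonglongrightarrow> \<pi> u - u"
    unfolding A_def[abs_def] B_def[abs_def] by (simp_all only: LIM_zero_iff)
qed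

text \<open>The distances to the fixed point \<open>u\<close> converge, and along the subsequence
  their limit is \<open>0\<close>.\<close>

lemma Fejer_tendsto:
  assumes "\<And>k. K \<le> k \<Longrightarrow> epi_subgradient C u (mu k *\<^sub>R (\<pi> u - u)) b"
    and "strict_mono r" "(y \<circ> r) \<longlonglongrightarrow> u"
  shows "y \<longlonglongrightarrow> u"
proof -
  have "convergent (\<lambda>k. norm (y k - u))" by (rule Fejer(1)) (rule assms(1))
  then obtain L where L: "(\<lambda>k. norm (y k - u)) \<longlonglongrightarrow> L" by (auto simp: convergent_def)
  moreover have "(\<lambda>n. norm ((y \<circ> r) n - u)) \<longlonglongrightarrow> 0"
    using tendsto_norm_zero[OF LIM_zero[OF assms(3)]] .
  moreover have "(\<lambda>n. norm ((y \<circ> r) n - u)) \<longlonglongrightarrow> L"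
    using LIMSEQ_subseq_LIMSEQ[OF L \<open>strict_mono r\<close>] by (simp add: o_def)
  ultimately have "L = 0" using LIMSEQ_unique by blast
  with L have "(\<lambda>k. y k - u) \<longlonglongrightarrow> 0" by (simp only: tendsto_norm_zero_iff)
  then show ?thesis by (simp only: LIM_zero_iff)
qed

lemma y_accumulates:
  obtains l r where "strict_mono r" "(y \<circ> r) \<longlonglongrightarrow> l"
  using bounded_imp_convergent_subsequence[OF bounded_y] by metis

text \<open>A multiplier in \<open>S\<close> is fixed by both maps, so both displacements vanish in
  the limit. An accumulation point then lies in \<open>S\<close> and is a multiplier, hence is
  itself a fixed point that attracts the whole sequence. Since \<open>mu\<close> converges, the
  scaled residuals vanish whether or not its limit is \<open>0\<close>.\<close>

lemma tendsto_multiplier: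
  assumes "mu \<longlonglongrightarrow> \<mu>" and u: "u \<in> S" "epi_subgradient C u 0 b"
  shows "\<exists>l\<in>S. epi_subgradient C l 0 a \<and> y \<longlonglongrightarrow> l"
proof -
  have \<pi>_id: "\<pi> v = v" if "v \<in> S" for v using that by (rule closest_point_self)
  have fixp: "epi_subgradient C v (mu k *\<^sub>R (\<pi> v - v)) b'" if "v \<in> S" "epi_subgradient C v 0 b'" for v k b'
    using that \<pi>_id[OF that(1)] by simp
  have "(\<lambda>k. y k - \<pi> (y k)) \<longlonglongrightarrow> u - \<pi> u" by (rule Fejer(2)) (rule fixp[OF u])
  then have dist: "(\<lambda>k. y k - \<pi> (y k)) \<longlonglongrightarrow> 0" using \<pi>_id[OF u(1)] by simp
  have "(\<lambda>k. \<pi> (y k) - p k) \<longlonglongrightarrow> \<pi> u - u" by (rule Fejer(3)) (rule fixp[OF u])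
  then have "(\<lambda>k. \<pi> (y k) - p k) \<longlonglongrightarrow> 0" using \<pi>_id[OF u(1)] by simp
  from tendsto_scaleR[OF \<open>mu \<longlonglongrightarrow> \<mu>\<close> this]
  have w: "(\<lambda>k. mu k *\<^sub>R (\<pi> (y k) - p k)) \<longlonglongrightarrow> 0" by simp
  obtain l r where r: "strict_mono r" and l: "(y \<circ> r) \<longlonglongrightarrow> l" by (rule y_accumulates)
  have "(\<lambda>n. y (r n) - \<pi> (y (r n))) \<longlonglongrightarrow> 0"
    using LIMSEQ_subseq_LIMSEQ[OF dist r] by (simp add: o_def)
  then have "(\<lambda>n. y (r n) - (y (r n) - \<pi> (y (r n)))) \<longlonglongrightarrow> l - 0"
    using l by (intro tendsto_diff) (simp_all add: o_def)
  then have "(\<lambda>n. \<pi> (y (r n))) \<longlonglongrightarrow> l" by simp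
  then have "l \<in> S"
    by (rule closed_sequentially[OF closed_S, rotated]) (use closed_S S in \<open>simp add: closest_point_in_set\<close>)
  moreover have "epi_subgradient C l 0 a" using accumulation_multiplier[OF w r l] .
  ultimately have "y \<longlonglongrightarrow> l" by (intro Fejer_tendsto[OF _ r l] fixp)
  with \<open>l \<in> S\<close> \<open>epi_subgradient C l 0 a\<close> show ?thesis by blast
qed

text \<open>Brouwer's theorem supplies a fixed point \<open>u\<close>, and comparison with
  \<open>u\<close> shows that \<open>y k - p k\<close> tends to \<open>0\<close>. By continuity
  every accumulation point is then a fixed point, and comparison with one of these gives
  convergence.\<close>

lemma tendsto_fixed_point:
  assumes const: "\<And>k. K \<le> k \<Longrightarrow> mu k = \<mu>" and "0 < \<mu>"
  shows "\<exists>l b. y \<longlonglongrightarrow> l \<and> epi_subgradient C l (\<mu> *\<^sub>R (\<pi> l - l)) b"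
proof -
  have "C \<noteq> {}" using multiplier by (auto simp: epi_subgradient_def)
  moreover have "a + q \<bullet> w \<le> r" if "(w, r) \<in> C" for w r
    using epi_subgradientD[OF multiplier that] by simp
  ultimately have "\<exists>p b. epi_subgradient C p (\<mu> *\<^sub>R (v - p)) b" for v
    by (rule epi_prox_exists[OF C _ _ \<open>0 < \<mu>\<close>])
  then obtain P b where P: "\<And>v. epi_subgradient C (P v) (\<mu> *\<^sub>R (v - P v)) (b v)" by metis
  have lip: "norm (P v - P v') \<le> norm (v - v')" for v v'
    using epi_prox_nonexpansive[OF P P \<open>0 < \<mu>\<close>] .
  have contP: "continuous_on UNIV P"
    by (rule lipschitz_on_continuous_on[of 1]) (use lip in \<open>auto simp: lipschitz_on_def dist_norm\<close>)
  have cont: "continuous_on UNIV (\<lambda>v. P (\<pi> v))"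
    by (rule continuous_on_compose2[OF contP])
      (use S closed_S continuous_on_closest_point in auto)
  obtain R where R: "\<And>s. s \<in> S \<Longrightarrow> norm s \<le> R"
    using compact_imp_bounded[OF S(3)] unfolding bounded_iff by blast
  \<comment> \<open>Nonexpansiveness compares \<open>P (\<pi> v)\<close> with \<open>P 0\<close>,
    and \<open>\<pi> v\<close> lies in \<open>S\<close>, whose points have norm at most
    \<open>R\<close>.\<close>
  have img: "P (\<pi> v) \<in> cball 0 (norm (P 0) + R)" for v
    using lip[of "\<pi> v" 0] R[of "\<pi> v"] closest_point_in_set[OF closed_S S(1), of v]
      norm_triangle_sub[of "P (\<pi> v)" "P 0"] by simp
  have "0 \<le> norm (P 0) + R"
    using S(1) R norm_ge_zero by (metis add_nonneg_nonneg ex_in_conv order_trans)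
  then have "cball 0 (norm (P 0) + R) \<noteq> ({} :: 'b set)" by simp
  then obtain u where u: "P (\<pi> u) = u"
    by (rule brouwer[OF compact_cball convex_cball _ continuous_on_subset[OF cont subset_UNIV]])
      (use img in blast)+
  have "epi_subgradient C u (\<mu> *\<^sub>R (\<pi> u - u)) (b (\<pi> u))" using P[of "\<pi> u"] by (simp add: u)
  then have fixp: "epi_subgradient C u (mu k *\<^sub>R (\<pi> u - u)) (b (\<pi> u))" if "K \<le> k" for k
    using const[OF that] by simp
  have "(\<lambda>k. y k - \<pi> (y k)) \<longlonglongrightarrow> u - \<pi> u" by (rule Fejer(2)) (rule fixp)
  moreover have "(\<lambda>k. \<pi> (y k) - p k) \<longlonglongrightarrow> \<pi> u - u" by (rule Fejer(3)) (rule fixp)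
  \<comment> \<open>The limits of the two displacements are opposite vectors and cancel.\<close>
  ultimately have "(\<lambda>k. (y k - \<pi> (y k)) + (\<pi> (y k) - p k)) \<longlonglongrightarrow> (u - \<pi> u) + (\<pi> u - u)"
    by (rule tendsto_add)
  then have yp: "(\<lambda>k. y k - p k) \<longlonglongrightarrow> 0" by simp
  \<comment> \<open>Nonexpansiveness for equal inputs is uniqueness of the proximal point.\<close>
  have p_eq: "p k = P (\<pi> (y k))" if "K \<le> k" for k
    using epi_prox_nonexpansive[OF prox[of k, unfolded const[OF that]] P[of "\<pi> (y k)"] \<open>0 < \<mu>\<close>] by simp
  obtain l r where r: "strict_mono r" and l: "(y \<circ> r) \<longlonglongrightarrow> l" by (rule y_accumulates)
  have "(\<lambda>n. P (\<pi> ((y \<circ> r) n))) \<longlonglongrightarrow> P (\<pi> l)"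
    using continuous_on_tendsto_compose[OF cont l] by simp
  moreover have "\<forall>\<^sub>F n in sequentially. P (\<pi> ((y \<circ> r) n)) = p (r n)"
    using eventually_ge_at_top[of K]
  proof eventually_elim
    fix n assume "K \<le> n"
    then have "K \<le> r n" using seq_suble[OF r, of n] by linarith
    then show "P (\<pi> ((y \<circ> r) n)) = p (r n)" by (simp add: p_eq)
  qed
  ultimately have "(\<lambda>n. p (r n)) \<longlonglongrightarrow> P (\<pi> l)" by (simp add: tendsto_cong)
  moreover have "(\<lambda>n. (y \<circ> r) n - (y (r n) - p (r n))) \<longlonglongrightarrow> l - 0"
    using LIMSEQ_subseq_LIMSEQ[OF yp r] by (intro tendsto_diff l) (simp add: o_def)
  ultimately have "P (\<pi> l) = l" by (intro LIMSEQ_unique[of "\<lambda>n. p (r n)"]) simp_all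
  then have l_fixed: "epi_subgradient C l (\<mu> *\<^sub>R (\<pi> l - l)) (b (\<pi> l))" using P[of "\<pi> l"] by simp
  then have "epi_subgradient C l (mu k *\<^sub>R (\<pi> l - l)) (b (\<pi> l))" if "K \<le> k" for k
    using const[OF that] by simp
  then have "y \<longlonglongrightarrow> l" by (rule Fejer_tendsto[OF _ r l])
  with l_fixed show ?thesis by blast
qed

end

section \<open>The perturbation function and the multipliers\<close>

definition eepi :: "('a \<Rightarrow> ereal) \<Rightarrow> ('a \<times> real) set" where
  "eepi \<phi> = {(z, s). \<phi> z \<le> ereal s}"

text \<open>The epigraph, up to boundary points, of \<open>w \<mapsto> inf\<^sub>x f x + g (c x + w)\<close>.\<close>

definition value_epi ::
    "('a \<Rightarrow> real) \<Rightarrow> ('b::plus \<Rightarrow> ereal) \<Rightarrow> ('a \<Rightarrow> 'b) \<Rightarrow> ('b \<times> real) set" where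
  "value_epi f g c = {(w, r). \<exists>x. (c x + w, r - f x) \<in> eepi g}"

lemma eepi_iff [simp]: "(z, s) \<in> eepi \<phi> \<longleftrightarrow> \<phi> z \<le> ereal s"
  by (simp add: eepi_def)

lemma value_epi_iff: "(w, r) \<in> value_epi f g c \<longleftrightarrow> (\<exists>x. g (c x + w) \<le> ereal (r - f x))"
  by (simp add: value_epi_def)

text \<open>A level \<open>s'\<close> strictly between \<open>s\<close> and \<open>\<phi> z\<close>
  separates a neighbourhood from the epigraph. The lower limit in \<open>lsc\<close> ignores the
  point \<open>z\<close> itself, which is therefore treated separately.\<close>

lemma closed_eepi:
  fixes \<phi> :: "'a::topological_space \<Rightarrow> ereal"
  assumes "lsc \<phi>"
  shows "closed (eepi \<phi>)"
  unfolding closed_def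
proof (subst open_subopen, rule ballI)
  fix u assume "u \<in> - eepi \<phi>"
  then obtain z s where u: "u = (z, s)" and "ereal s < \<phi> z" by (cases u) auto
  then obtain s' where s': "s < s'" "ereal s' < \<phi> z"
    using ereal_dense2[of "ereal s" "\<phi> z"] by auto
  have "\<phi> z \<le> Liminf (at z) \<phi>" using assms by (simp add: lsc_def)
  then have "\<forall>\<^sub>F w in at z. ereal s' < \<phi> w"
    using s'(2) by (simp add: le_Liminf_iff)
  then obtain U where U: "open U" "z \<in> U" "\<And>w. w \<in> U \<Longrightarrow> w \<noteq> z \<Longrightarrow> ereal s' < \<phi> w"
    unfolding eventually_at_topological by auto
  have "U \<times> {..<s'} \<subseteq> - eepi \<phi>"
  proof clarify
    fix w r assume "w \<in> U" "r < s'" "(w, r) \<in> eepi \<phi>"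
    then have "ereal s' < \<phi> w" using U(3) s'(2) by (cases "w = z") auto
    also have "\<phi> w \<le> ereal r" using \<open>(w, r) \<in> eepi \<phi>\<close> by simp
    finally show False using \<open>r < s'\<close> by simp
  qed
  moreover have "open (U \<times> {..<s'})" using U(1) by (intro open_Times) auto
  moreover have "u \<in> U \<times> {..<s'}" using u U(2) s'(1) by simp
  ultimately show "\<exists>T. open T \<and> u \<in> T \<and> T \<subseteq> - eepi \<phi>" by blast
qed

lemma convex_eepi:
  assumes "econvex \<phi>"
  shows "convex (eepi \<phi>)"
  unfolding convex_def
proof clarify
  fix z s w r and t t' :: real
  assume zs: "(z, s) \<in> eepi \<phi>" and wr: "(w, r) \<in> eepi \<phi>" and t: "0 \<le> t" "0 \<le> t'" "t + t' = 1"
  have t': "t' = 1 - t" using t by simp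
  have "\<phi> (t *\<^sub>R z + t' *\<^sub>R w) \<le> ereal t * \<phi> z + ereal t' * \<phi> w"
    using assms t unfolding econvex_def t' by simp
  also have "\<dots> \<le> ereal t * ereal s + ereal t' * ereal r"
    using zs wr t by (intro add_mono ereal_mult_left_mono) auto
  finally show "t *\<^sub>R (z, s) + t' *\<^sub>R (w, r) \<in> eepi \<phi>" by simp
qed

lemma eepi_hzn:
  assumes "v \<in> hzn \<phi>" "\<phi> z \<le> ereal s"
  shows "\<phi> (z + v) \<le> ereal s"
proof -
  have "z \<in> edom \<phi>" using assms(2) by (auto simp: edom_def)
  then show ?thesis using assms order_trans unfolding hzn_def by blast
qed

text \<open>The convexity defect \<open>v\<close> of \<open>c\<close> is a horizon direction of
  \<open>g\<close>, so shifting the argument of \<open>g\<close> by \<open>v\<close> does not raise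
  its value and absorbs the defect.\<close>

lemma convex_value_epi:
  assumes f: "convex_on UNIV f" and g: "econvex g"
    and c: "\<forall>x x'. \<forall>t\<in>{0..1}. c (t *\<^sub>R x + (1 - t) *\<^sub>R x') - t *\<^sub>R c x - (1 - t) *\<^sub>R c x' \<in> hzn g"
  shows "convex (value_epi f g c)"
  unfolding convex_def
proof clarify
  fix w1 r1 w2 r2 and t t' :: real
  assume 1: "(w1, r1) \<in> value_epi f g c" and 2: "(w2, r2) \<in> value_epi f g c"
    and t: "0 \<le> t" "0 \<le> t'" "t + t' = 1"
  obtain x1 where x1: "(c x1 + w1, r1 - f x1) \<in> eepi g" using 1 by (auto simp: value_epi_iff)
  obtain x2 where x2: "(c x2 + w2, r2 - f x2) \<in> eepi g" using 2 by (auto simp: value_epi_iff)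
  have t': "t' = 1 - t" using t by simp
  define x where "x = t *\<^sub>R x1 + t' *\<^sub>R x2"
  define v where "v = c x - t *\<^sub>R c x1 - t' *\<^sub>R c x2"
  have v: "v \<in> hzn g" using c t unfolding v_def x_def t' by simp
  have "t *\<^sub>R (c x1 + w1, r1 - f x1) + t' *\<^sub>R (c x2 + w2, r2 - f x2) \<in> eepi g"
    using convexD[OF convex_eepi[OF g] x1 x2] t by simp
  then have "g (t *\<^sub>R (c x1 + w1) + t' *\<^sub>R (c x2 + w2)) \<le> ereal (t * (r1 - f x1) + t' * (r2 - f x2))"
    by simp
  from eepi_hzn[OF v this]
  have "g (c x + (t *\<^sub>R w1 + t' *\<^sub>R w2)) \<le> ereal (t * (r1 - f x1) + t' * (r2 - f x2))"
    by (simp add: v_def algebra_simps)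
  also have "f x \<le> t * f x1 + t' * f x2"
    using f t unfolding x_def convex_on_def by simp
  then have "ereal (t * (r1 - f x1) + t' * (r2 - f x2)) \<le> ereal (t * r1 + t' * r2 - f x)"
    by (simp add: algebra_simps)
  finally show "t *\<^sub>R (w1, r1) + t' *\<^sub>R (w2, r2) \<in> value_epi f g c"
    by (auto simp: value_epi_iff)
qed

section \<open>Multipliers as subgradients of the perturbation function at zero\<close>

lemma properD:
  assumes "proper \<phi>" "\<phi> z < \<infinity>"
  obtains s where "\<phi> z = ereal s"
  using assms by (cases "\<phi> z") (auto simp: proper_def)

text \<open>Restrict \<open>h\<close> to the line through \<open>x\<close> and \<open>x'\<close> and
  compare with the horizontal tangent at \<open>x\<close>.\<close>

lemma convex_on_derivative_zero_min:
  fixes h :: "'a::real_normed_vector \<Rightarrow> real"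
  assumes "convex_on UNIV h" "(h has_derivative (\<lambda>_. 0)) (at x)"
  shows "h x \<le> h x'"
proof -
  define \<psi> where "\<psi> t = h (x + t *\<^sub>R (x' - x))" for t
  have "convex_on UNIV \<psi>"
  proof (intro convex_onI)
    fix t s s' :: real assume t: "0 < t" "t < 1"
    have "x + ((1 - t) * s + t * s') *\<^sub>R (x' - x)
        = (1 - t) *\<^sub>R (x + s *\<^sub>R (x' - x)) + t *\<^sub>R (x + s' *\<^sub>R (x' - x))"
      by (simp add: algebra_simps)
    then show "\<psi> ((1 - t) *\<^sub>R s + t *\<^sub>R s') \<le> (1 - t) * \<psi> s + t * \<psi> s'"
      using convex_onD[OF assms(1), of t "x + s *\<^sub>R (x' - x)" "x + s' *\<^sub>R (x' - x)"] t
      by (simp add: \<psi>_def)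
  qed auto
  moreover have "(\<psi> has_real_derivative 0) (at 0)"
  proof -
    have "((\<lambda>t. x + t *\<^sub>R (x' - x)) has_derivative (\<lambda>t. t *\<^sub>R (x' - x))) (at 0)"
      by (auto intro!: derivative_eq_intros)
    from diff_chain_at[OF this, of h "\<lambda>_. 0"] assms(2)
    show ?thesis by (simp add: \<psi>_def[abs_def] has_field_derivative_def o_def flip: lambda_zero)
  qed
  ultimately have "0 * (1 - 0) \<le> \<psi> 1 - \<psi> 0"
    by (intro convex_on_imp_above_tangent[of UNIV \<psi> 0 1 0]) auto
  then show ?thesis by (simp add: \<psi>_def)
qed

lemma subdifferentialD:
  assumes "p \<in> subdifferential g z"
  shows "z \<in> edom g" "g z + ereal (p \<bullet> (w - z)) \<le> g w"
  using assms by (auto simp: subdifferential_def split: if_splits)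

text \<open>Test the subgradient inequality at \<open>z + v\<close>, where \<open>g\<close> is no
  larger than at \<open>z\<close>. This sign is what makes \<open>p \<bullet> c x\<close> convex in
  \<open>x\<close>.\<close>

lemma subgradient_inner_hzn:
  assumes "proper g" "p \<in> subdifferential g z" "v \<in> hzn g"
  shows "p \<bullet> v \<le> 0"
proof -
  note z = subdifferentialD(1)[OF assms(2)] and sub = subdifferentialD(2)[OF assms(2), of "z + v"]
  obtain s where s: "g z = ereal s" using properD[OF assms(1)] z by (auto simp: edom_def)
  have "g (z + v) \<le> ereal s" using eepi_hzn[OF assms(3)] s by simp
  from order_trans[OF sub this] s show ?thesis by simp
qed

lemma lagrangian_has_derivative:
  assumes "composite_data f g c gradf J"
  shows "((\<lambda>x. f x + p \<bullet> c x) has_derivative (\<lambda>h. h \<bullet> (gradf x + transpose (J x) *v p))) (at x)"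
proof -
  have "(f has_derivative (\<lambda>h. h \<bullet> gradf x)) (at x)" "(c has_derivative (\<lambda>h. J x *v h)) (at x)"
    using assms by (auto simp: composite_data_def gderiv_def)
  then have "((\<lambda>x. f x + p \<bullet> c x) has_derivative (\<lambda>h. h \<bullet> gradf x + p \<bullet> (J x *v h))) (at x)"
    by (auto intro!: derivative_eq_intros)
  moreover have "p \<bullet> (J x *v h) = h \<bullet> (transpose (J x) *v p)" for h
    by (simp add: dot_lmul_matrix[symmetric] inner_commute)
  ultimately show ?thesis by (simp add: inner_add_right)
qed

text \<open>For a multiplier the convex function \<open>f x + p \<bullet> c x\<close> has zero
  gradient, hence a global minimum at \<open>x\<close>; the subgradient inequality of
  \<open>g\<close> does the rest. The right-hand side depends on \<open>x\<close> only through the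
  objective value, which is why minimizers share their multipliers.\<close>

lemma multipliers_iff:
  assumes data: "composite_data f g c gradf J" and x: "g (c x) = ereal s"
  shows "p \<in> multipliers g c gradf J x \<longleftrightarrow> (\<forall>(w, r)\<in>value_epi f g c. f x + s + p \<bullet> w \<le> r)"
proof
  have f: "convex_on UNIV f" and g: "proper g"
    and c: "\<And>x x' t. t \<in> {0..1} \<Longrightarrow> c (t *\<^sub>R x + (1 - t) *\<^sub>R x') - t *\<^sub>R c x - (1 - t) *\<^sub>R c x' \<in> hzn g"
    using data by (auto simp: composite_data_def)
  assume p: "p \<in> multipliers g c gradf J x"
  then have sub: "p \<in> subdifferential g (c x)" and grad: "gradf x + transpose (J x) *v p = 0"
    by (auto simp: multipliers_def)
  have "convex_on UNIV (\<lambda>x. f x + p \<bullet> c x)"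
  proof (intro convex_onI)
    fix t :: real and x x' assume t: "0 < t" "t < 1"
    have "p \<bullet> (c ((1 - t) *\<^sub>R x + t *\<^sub>R x') - (1 - t) *\<^sub>R c x - t *\<^sub>R c x') \<le> 0"
      using c[of "1 - t" x x'] t by (intro subgradient_inner_hzn[OF g sub]) simp
    then have "p \<bullet> c ((1 - t) *\<^sub>R x + t *\<^sub>R x') \<le> (1 - t) * (p \<bullet> c x) + t * (p \<bullet> c x')"
      by (simp add: inner_diff_right)
    moreover have "f ((1 - t) *\<^sub>R x + t *\<^sub>R x') \<le> (1 - t) * f x + t * f x'"
      using convex_onD[OF f, of t x x'] t by simp
    ultimately show "f ((1 - t) *\<^sub>R x + t *\<^sub>R x') + p \<bullet> c ((1 - t) *\<^sub>R x + t *\<^sub>R x')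
        \<le> (1 - t) * (f x + p \<bullet> c x) + t * (f x' + p \<bullet> c x')"
      by (simp add: algebra_simps)
  qed auto
  moreover have "((\<lambda>x. f x + p \<bullet> c x) has_derivative (\<lambda>_. 0)) (at x)"
    using lagrangian_has_derivative[OF data, of p x] grad by simp
  ultimately have min: "f x + p \<bullet> c x \<le> f x' + p \<bullet> c x'" for x'
    by (rule convex_on_derivative_zero_min)
  show "\<forall>(w, r)\<in>value_epi f g c. f x + s + p \<bullet> w \<le> r"
  proof clarify
    fix w r assume "(w, r) \<in> value_epi f g c"
    then obtain x' where x': "g (c x' + w) \<le> ereal (r - f x')" by (auto simp: value_epi_iff)
    have "ereal (s + p \<bullet> (c x' + w - c x)) \<le> ereal (r - f x')"
      using order_trans[OF subdifferentialD(2)[OF sub] x'] by (simp add: x)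
    then show "f x + s + p \<bullet> w \<le> r"
      using min[of x'] by (simp add: inner_diff_right inner_add_right)
  qed
next
  assume R: "\<forall>(w, r)\<in>value_epi f g c. f x + s + p \<bullet> w \<le> r"
  have key: "f x + s + p \<bullet> w \<le> f x' + s'" if "g (c x' + w) = ereal s'" for x' w s'
  proof -
    have "(w, f x' + s') \<in> value_epi f g c"
      unfolding value_epi_iff by (rule exI[of _ x']) (simp add: that)
    with R show ?thesis by blast
  qed
  have g: "proper g" using data by (auto simp: composite_data_def)
  \<comment> \<open>Keeping the point \<open>x\<close> and varying the perturbation isolates the
    subgradient condition on \<open>g\<close>.\<close>
  have "g (c x) + ereal (p \<bullet> (w - c x)) \<le> g w" for w
  proof (cases "g w < \<infinity>")
    case True
    then obtain s' where "g w = ereal s'" by (rule properD[OF g])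
    then show ?thesis using key[of x "w - c x" s'] x by simp
  qed auto
  then have "p \<in> subdifferential g (c x)"
    using x by (auto simp: subdifferential_def edom_def)
  \<comment> \<open>The perturbation \<open>c x - c x'\<close> keeps the argument of
    \<open>g\<close> at \<open>c x\<close>, which isolates minimality of \<open>x\<close> for
    \<open>f + p \<bullet> c\<close>.\<close>
  moreover have "f x + p \<bullet> c x \<le> f x' + p \<bullet> c x'" for x'
    using key[of x' "c x - c x'" s] x by (simp add: inner_diff_right)
  then have "(\<lambda>h. h \<bullet> (gradf x + transpose (J x) *v p)) = (\<lambda>_. 0)"
    by (intro differential_zero_maxmin[OF UNIV_I open_UNIV lagrangian_has_derivative[OF data]]) auto
  from fun_cong[OF this, of "gradf x + transpose (J x) *v p"]
  have "gradf x + transpose (J x) *v p = 0" by (simp only: inner_eq_zero_iff)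
  ultimately show "p \<in> multipliers g c gradf J x" by (simp add: multipliers_def)
qed

section \<open>The augmented Lagrangian and the dual function\<close>

text \<open>For \<open>a = v\<close> the last summand is exactly what \<open>aug_lagrangian\<close>
  subtracts, leaving a quadratic penalty and a linear term in the perturbation.\<close>

lemma norm_diff_scaled_expand:
  fixes w a :: "'b::real_inner"
  assumes "0 < \<mu>"
  shows "(norm (w - \<mu> *\<^sub>R a))\<^sup>2 / (2 * \<mu>) = (norm w)\<^sup>2 / (2 * \<mu>) - a \<bullet> w + \<mu> / 2 * (norm a)\<^sup>2"
proof -
  have "(norm (w - \<mu> *\<^sub>R a))\<^sup>2 = (norm w)\<^sup>2 - 2 * \<mu> * (a \<bullet> w) + \<mu>\<^sup>2 * (norm a)\<^sup>2"
    unfolding power2_norm_eq_inner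
    by (simp add: inner_diff_left inner_diff_right inner_commute power2_eq_square algebra_simps)
  then show ?thesis using assms by (simp add: field_simps power2_eq_square)
qed

text \<open>Shows that the definite description in \<open>prox\<close> denotes a minimizer:
  existence comes from \<open>epi_prox_exists\<close> with the affine minorant given by
  \<open>q\<close>, uniqueness from quadratic growth. The conclusion is the minimality divided by
  \<open>\<mu>\<close>.\<close>

lemma prox_characterization:
  fixes \<phi> :: "'b::euclidean_space \<Rightarrow> ereal" and v :: 'b
  assumes \<phi>: "proper \<phi>" "lsc \<phi>" "econvex \<phi>" and sub: "q \<in> subdifferential \<phi> z0" and "0 < \<mu>"
  defines "z \<equiv> prox (\<lambda>w. ereal \<mu> * \<phi> w) (\<mu> *\<^sub>R v)"
  obtains s where "\<phi> z = ereal s"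
    and "\<And>w r. \<phi> w \<le> ereal r \<Longrightarrow>
      s + (norm (z - \<mu> *\<^sub>R v))\<^sup>2 / (2 * \<mu>) \<le> r + (norm (w - \<mu> *\<^sub>R v))\<^sup>2 / (2 * \<mu>)"
proof -
  obtain s0 where s0: "\<phi> z0 = ereal s0"
    using properD[OF \<phi>(1)] subdifferentialD(1)[OF sub] by (auto simp: edom_def)
  have minorant: "s0 - q \<bullet> z0 + q \<bullet> w \<le> r" if "(w, r) \<in> eepi \<phi>" for w r
  proof -
    have "\<phi> w \<le> ereal r" using that by simp
    from order_trans[OF subdifferentialD(2)[OF sub] this] show ?thesis
      by (simp add: s0 inner_diff_right)
  qed
  have "(z0, s0) \<in> eepi \<phi>" using s0 by simp
  then have "eepi \<phi> \<noteq> {}" by blast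
  from epi_prox_exists[OF closed_eepi[OF \<phi>(2)] convex_eepi[OF \<phi>(3)] this minorant \<open>0 < \<mu>\<close>]
  obtain p s where ps: "epi_subgradient (eepi \<phi>) p (\<mu> *\<^sub>R (v - p)) s" by blast
  define Z where "Z = \<mu> *\<^sub>R (v - p)"
  have Zs: "\<phi> Z \<le> ereal s" using ps by (simp add: epi_subgradient_def Z_def)
  then have "\<phi> Z < \<infinity>" by (rule le_less_trans) simp
  then obtain s' where s': "\<phi> Z = ereal s'" by (rule properD[OF \<phi>(1)])
  then have "(\<mu> *\<^sub>R (v - p), s') \<in> eepi \<phi>" by (simp add: Z_def)
  \<comment> \<open>The height \<open>s\<close> is only known to bound \<open>\<phi> Z\<close> from
    above; the subgradient inequality at \<open>Z\<close> itself gives the other direction.\<close>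
  from epi_subgradientD[OF ps this] have "s' = s" using Zs s' by simp
  with s' have Z: "\<phi> Z = ereal s" by simp
  have growth: "s + (norm (Z - \<mu> *\<^sub>R v))\<^sup>2 / (2 * \<mu>) + (norm (w - Z))\<^sup>2 / (2 * \<mu>)
      \<le> r + (norm (w - \<mu> *\<^sub>R v))\<^sup>2 / (2 * \<mu>)" if "\<phi> w \<le> ereal r" for w r
  proof -
    have "(w, r) \<in> eepi \<phi>" using that by simp
    from epi_subgradient_growth[OF ps this \<open>0 < \<mu>\<close>] show ?thesis
      unfolding norm_diff_scaled_expand[OF \<open>0 < \<mu>\<close>] Z_def by linarith
  qed
  have \<mu>2: "\<mu> * (t / (2 * \<mu>)) = t / 2" for t using \<open>0 < \<mu>\<close> by simp
  have scaled: "\<mu> * s + (norm (Z - \<mu> *\<^sub>R v))\<^sup>2 / 2 + (norm (w - Z))\<^sup>2 / 2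
      \<le> \<mu> * r + (norm (w - \<mu> *\<^sub>R v))\<^sup>2 / 2" if "\<phi> w \<le> ereal r" for w r
    using mult_left_mono[OF growth[OF that], of \<mu>] \<open>0 < \<mu>\<close> by (simp only: distrib_left \<mu>2)
  let ?h = "\<lambda>w. ereal \<mu> * \<phi> w + ereal (1 / 2 * (norm (w - \<mu> *\<^sub>R v))\<^sup>2)"
  have "is_minimizer ?h Z"
    unfolding is_minimizer_def
  proof (intro conjI allI)
    show "Z \<in> edom ?h" by (simp add: edom_def Z)
    fix w
    show "?h Z \<le> ?h w"
    proof (cases "\<phi> w < \<infinity>")
      case True
      then obtain r where r: "\<phi> w = ereal r" by (rule properD[OF \<phi>(1)])
      then have "\<mu> * s + (norm (Z - \<mu> *\<^sub>R v))\<^sup>2 / 2 + (norm (w - Z))\<^sup>2 / 2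
          \<le> \<mu> * r + (norm (w - \<mu> *\<^sub>R v))\<^sup>2 / 2" by (intro scaled) simp
      moreover have "0 \<le> (norm (w - Z))\<^sup>2 / 2" by simp
      ultimately have "\<mu> * s + (norm (Z - \<mu> *\<^sub>R v))\<^sup>2 / 2 \<le> \<mu> * r + (norm (w - \<mu> *\<^sub>R v))\<^sup>2 / 2"
        by linarith
      then show ?thesis by (simp add: Z r)
    next
      case False
      then show ?thesis using \<open>0 < \<mu>\<close> by simp
    qed
  qed
  moreover have "W = Z" if W: "is_minimizer ?h W" for W
  proof -
    have "\<phi> W < \<infinity>" using W \<open>0 < \<mu>\<close> by (cases "\<phi> W") (auto simp: is_minimizer_def edom_def)
    then obtain r where r: "\<phi> W = ereal r" by (rule properD[OF \<phi>(1)])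
    have "?h W \<le> ?h Z" using W by (simp add: is_minimizer_def)
    then have "\<mu> * r + (norm (W - \<mu> *\<^sub>R v))\<^sup>2 / 2 \<le> \<mu> * s + (norm (Z - \<mu> *\<^sub>R v))\<^sup>2 / 2"
      by (simp add: Z r)
    moreover have "\<mu> * s + (norm (Z - \<mu> *\<^sub>R v))\<^sup>2 / 2 + (norm (W - Z))\<^sup>2 / 2
          \<le> \<mu> * r + (norm (W - \<mu> *\<^sub>R v))\<^sup>2 / 2" by (rule scaled) (simp add: r)
    ultimately have "(norm (W - Z))\<^sup>2 \<le> 0" by linarith
    then show ?thesis by simp
  qed
  ultimately have "z = Z" unfolding z_def prox_def by (rule the_equality)
  show thesis
  proof (rule that)
    show "\<phi> z = ereal s" using Z \<open>z = Z\<close> by simp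
    fix w r assume "\<phi> w \<le> ereal r"
    from growth[OF this] show "s + (norm (z - \<mu> *\<^sub>R v))\<^sup>2 / (2 * \<mu>) \<le> r + (norm (w - \<mu> *\<^sub>R v))\<^sup>2 / (2 * \<mu>)"
      using \<open>0 < \<mu>\<close> \<open>z = Z\<close> zero_le_power2[of "norm (w - Z)"]
      by (smt (verit) divide_nonneg_nonneg)
  qed
qed

text \<open>The Moreau envelope is tested at \<open>c x + w\<close>.\<close>

lemma aug_lagrangian_le:
  fixes c :: "'a \<Rightarrow> 'b::real_inner"
  assumes "0 < \<mu>" "g (c x + w) \<le> ereal (r - f x)"
  shows "aug_lagrangian f g c \<mu> x v \<le> ereal (r + (norm w)\<^sup>2 / (2 * \<mu>) - v \<bullet> w)"
proof -
  have "moreau_envelope \<mu> g (c x + \<mu> *\<^sub>R v)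
      \<le> g (c x + w) + ereal (1 / (2 * \<mu>) * (norm ((c x + w) - (c x + \<mu> *\<^sub>R v)))\<^sup>2)"
    unfolding moreau_envelope_def by (rule INF_lower) simp
  also have "\<dots> \<le> ereal (r - f x) + ereal ((norm (w - \<mu> *\<^sub>R v))\<^sup>2 / (2 * \<mu>))"
    using assms(2) by (intro add_mono) simp_all
  finally have M: "moreau_envelope \<mu> g (c x + \<mu> *\<^sub>R v)
      \<le> ereal (r - f x + ((norm w)\<^sup>2 / (2 * \<mu>) - v \<bullet> w + \<mu> / 2 * (norm v)\<^sup>2))"
    by (simp add: norm_diff_scaled_expand[OF \<open>0 < \<mu>\<close>])
  show ?thesis
    using M unfolding aug_lagrangian_def
    by (cases "moreau_envelope \<mu> g (c x + \<mu> *\<^sub>R v)") auto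
qed

text \<open>The infimum in the Moreau envelope is attained at \<open>z\<close>, so the bound of
  \<open>aug_lagrangian_le\<close> is exact for the perturbation \<open>z - c x\<close>.\<close>

lemma aug_lagrangian_eq:
  fixes c :: "'a \<Rightarrow> 'b::real_inner"
  assumes "0 < \<mu>" and z: "g z = ereal s" and "proper g"
    and min: "\<And>w r. g w \<le> ereal r \<Longrightarrow>
      s + (norm (z - (c x + \<mu> *\<^sub>R v)))\<^sup>2 / (2 * \<mu>) \<le> r + (norm (w - (c x + \<mu> *\<^sub>R v)))\<^sup>2 / (2 * \<mu>)"
  shows "aug_lagrangian f g c \<mu> x v
    = ereal (f x + s + (norm (z - c x))\<^sup>2 / (2 * \<mu>) - v \<bullet> (z - c x))"
proof (rule antisym)
  show "aug_lagrangian f g c \<mu> x v \<le> ereal (f x + s + (norm (z - c x))\<^sup>2 / (2 * \<mu>) - v \<bullet> (z - c x))"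
    using z by (intro aug_lagrangian_le \<open>0 < \<mu>\<close>) simp
  have "ereal (s + (norm (z - (c x + \<mu> *\<^sub>R v)))\<^sup>2 / (2 * \<mu>)) \<le> moreau_envelope \<mu> g (c x + \<mu> *\<^sub>R v)"
    unfolding moreau_envelope_def
  proof (rule INF_greatest)
    fix w
    show "ereal (s + (norm (z - (c x + \<mu> *\<^sub>R v)))\<^sup>2 / (2 * \<mu>))
        \<le> g w + ereal (1 / (2 * \<mu>) * (norm (w - (c x + \<mu> *\<^sub>R v)))\<^sup>2)"
    proof (cases "g w < \<infinity>")
      case True
      then obtain r where r: "g w = ereal r" by (rule properD[OF \<open>proper g\<close>])
      then show ?thesis using min[of w r] by simp
    qed simp
  qed
  moreover have "z - (c x + \<mu> *\<^sub>R v) = (z - c x) - \<mu> *\<^sub>R v" by simp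
  ultimately have M: "ereal (s + ((norm (z - c x))\<^sup>2 / (2 * \<mu>) - v \<bullet> (z - c x) + \<mu> / 2 * (norm v)\<^sup>2))
      \<le> moreau_envelope \<mu> g (c x + \<mu> *\<^sub>R v)"
    by (simp only: norm_diff_scaled_expand[OF \<open>0 < \<mu>\<close>])
  show "ereal (f x + s + (norm (z - c x))\<^sup>2 / (2 * \<mu>) - v \<bullet> (z - c x)) \<le> aug_lagrangian f g c \<mu> x v"
    using M unfolding aug_lagrangian_def
    by (cases "moreau_envelope \<mu> g (c x + \<mu> *\<^sub>R v)") auto
qed

text \<open>Quadratic growth around the exact minimizer \<open>W\<close> bounds
  \<open>norm (w - W)\<close> by \<open>sqrt (2 * \<mu> * \<epsilon>)\<close>; the passage to
  multipliers divides by \<open>\<mu>\<close>.\<close>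

lemma inexact_epi_prox:
  fixes C :: "('b::euclidean_space \<times> real) set"
  assumes sub: "epi_subgradient C p (\<mu> *\<^sub>R (v - p)) \<rho>" and "(w, r) \<in> C" "0 < \<mu>"
    and approx: "\<And>w' r'. (w', r') \<in> C \<Longrightarrow>
      r + (norm w)\<^sup>2 / (2 * \<mu>) - v \<bullet> w \<le> r' + (norm w')\<^sup>2 / (2 * \<mu>) - v \<bullet> w' + \<epsilon>"
  shows "norm (v - (1 / \<mu>) *\<^sub>R w - p) \<le> sqrt 2 * sqrt (\<epsilon> / \<mu>)"
proof -
  define W where "W = \<mu> *\<^sub>R (v - p)"
  have "(W, \<rho>) \<in> C" using sub by (simp add: epi_subgradient_def W_def)
  from approx[OF this] have "(norm (w - W))\<^sup>2 / (2 * \<mu>) \<le> \<epsilon>"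
    using epi_subgradient_growth[OF sub \<open>(w, r) \<in> C\<close> \<open>0 < \<mu>\<close>] unfolding W_def by linarith
  then have "(norm (w - W) / \<mu>)\<^sup>2 \<le> 2 * (\<epsilon> / \<mu>)"
    using \<open>0 < \<mu>\<close> by (simp add: power_divide field_simps power2_eq_square)
  then have "norm (w - W) / \<mu> \<le> sqrt (2 * (\<epsilon> / \<mu>))" by (rule real_le_rsqrt)
  moreover have "v - (1 / \<mu>) *\<^sub>R w - p = (1 / \<mu>) *\<^sub>R (W - w)"
    using \<open>0 < \<mu>\<close> by (simp add: W_def algebra_simps)
  ultimately show ?thesis
    using \<open>0 < \<mu>\<close> by (simp add: norm_minus_commute real_sqrt_mult real_sqrt_divide)
qed

section \<open>The dual function through the closed perturbation epigraph\<close>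

lemma closure_le:
  fixes h k :: "'a::topological_space \<Rightarrow> real"
  assumes "\<And>u. u \<in> E \<Longrightarrow> h u \<le> k u" "continuous_on UNIV h" "continuous_on UNIV k" "u \<in> closure E"
  shows "h u \<le> k u"
proof -
  have "closure E \<subseteq> {u. h u \<le> k u}"
    using assms(1-3) by (intro closure_minimal closed_Collect_le) auto
  then show ?thesis using assms(4) by blast
qed

text \<open>The supremum in the conjugate is tested at \<open>c x + w\<close>; the resulting bound
  is continuous in \<open>(w, r)\<close> and so extends to the closure.\<close>

lemma dual_function_le:
  assumes "proper g" and C: "(w, r) \<in> closure (value_epi f g c)"
  shows "dual_function f g c v \<le> ereal (r - v \<bullet> w)"
proof -
  have le: "dual_function f g c v \<le> ereal (r - v \<bullet> w)" if wr: "(w, r) \<in> value_epi f g c" for w r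
  proof -
    obtain x where x: "g (c x + w) \<le> ereal (r - f x)" using wr by (auto simp: value_epi_iff)
    then have "g (c x + w) < \<infinity>" by (rule le_less_trans) simp
    then obtain s where s: "g (c x + w) = ereal s" by (rule properD[OF \<open>proper g\<close>])
    have "ereal (v \<bullet> (c x + w)) - g (c x + w) \<le> conjugate g v"
      unfolding conjugate_def by (rule SUP_upper) simp
    then have "ereal (v \<bullet> (c x + w) - s) \<le> conjugate g v" by (simp add: s)
    then have "lagrangian f g c x v \<le> ereal (f x + v \<bullet> c x - (v \<bullet> (c x + w) - s))"
      unfolding lagrangian_def by (cases "conjugate g v") auto
    also have "\<dots> \<le> ereal (r - v \<bullet> w)" using x by (simp add: s inner_add_right)
    finally show ?thesis
      unfolding dual_function_def by (rule INF_lower2[OF UNIV_I])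
  qed
  show ?thesis
  \<comment> \<open>\<open>closure_le\<close> compares real functions only, hence the split. The
    value \<open>\<infinity>\<close> contradicts \<open>le\<close> at any point of the nonempty
    epigraph.\<close>
  proof (cases "dual_function f g c v")
    case (real d)
    have "d \<le> snd (w, r) - v \<bullet> fst (w, r)"
      by (rule closure_le[OF _ _ _ C]) (use le real in \<open>auto intro!: continuous_intros\<close>)
    then show ?thesis by (simp add: real)
  next
    case PInf
    have "value_epi f g c \<noteq> {}" using C by (metis closure_empty empty_iff)
    then obtain u where "u \<in> value_epi f g c" by blast
    then show ?thesis using le[of "fst u" "snd u"] PInf by simp
  qed simp
qed

text \<open>The case of equality in \<open>dual_function_le\<close>: for each \<open>x\<close>, the
  subgradient inequality at the perturbation \<open>z - c x\<close> bounds every term of the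
  conjugate.\<close>

lemma dual_function_eq:
  assumes "proper g" and sub: "epi_subgradient (closure (value_epi f g c)) l w r"
  shows "dual_function f g c l = ereal (r - l \<bullet> w)"
proof (rule antisym)
  show "dual_function f g c l \<le> ereal (r - l \<bullet> w)"
    using sub by (intro dual_function_le \<open>proper g\<close>) (simp add: epi_subgradient_def)
  show "ereal (r - l \<bullet> w) \<le> dual_function f g c l"
    unfolding dual_function_def
  proof (rule INF_greatest)
    fix x
    have "conjugate g l \<le> ereal (f x + l \<bullet> c x - (r - l \<bullet> w))"
      unfolding conjugate_def
    proof (rule SUP_least)
      fix z
      show "ereal (l \<bullet> z) - g z \<le> ereal (f x + l \<bullet> c x - (r - l \<bullet> w))"
      proof (cases "g z < \<infinity>")
        case True
        then obtain s where s: "g z = ereal s" by (rule properD[OF \<open>proper g\<close>])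
        have "(z - c x, f x + s) \<in> value_epi f g c"
          unfolding value_epi_iff by (rule exI[of _ x]) (simp add: s)
        then have "(z - c x, f x + s) \<in> closure (value_epi f g c)"
          using closure_subset by blast
        from epi_subgradientD[OF sub this] show ?thesis
          by (simp add: s inner_diff_right)
      qed simp
    qed
    then show "ereal (r - l \<bullet> w) \<le> lagrangian f g c x l"
      unfolding lagrangian_def by (cases "conjugate g l") auto
  qed
qed

text \<open>The residual \<open>w\<close> bounds \<open>- dual_function f g c\<close> from below by
  an affine function of slope \<open>w\<close> touching it at \<open>l\<close>; the penalty has the
  tangent slope \<open>- w\<close> there. Adding the two bounds cancels the slopes.\<close>

lemma fixed_point_minimizes_dual:
  fixes c :: "'a \<Rightarrow> 'b::euclidean_space"
  assumes "proper g" and S: "convex S" "closed S" "S \<noteq> {}" and "0 < \<mu>"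
    and sub: "epi_subgradient (closure (value_epi f g c)) l (\<mu> *\<^sub>R (closest_point S l - l)) r"
  shows "is_minimizer (\<lambda>v. - dual_function f g c v + ereal (\<mu> / 2 * (infdist v S)\<^sup>2)) l"
  unfolding is_minimizer_def
proof (intro conjI allI)
  define w where "w = \<mu> *\<^sub>R (closest_point S l - l)"
  have l: "dual_function f g c l = ereal (r - l \<bullet> w)"
    unfolding w_def by (rule dual_function_eq[OF \<open>proper g\<close> sub])
  then show "l \<in> edom (\<lambda>v. - dual_function f g c v + ereal (\<mu> / 2 * (infdist v S)\<^sup>2))"
    by (simp add: edom_def)
  fix v
  have v: "dual_function f g c v \<le> ereal (r - v \<bullet> w)"
    using sub unfolding w_def by (intro dual_function_le \<open>proper g\<close>) (simp add: epi_subgradient_def)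
  have "\<mu> / 2 * ((infdist l S)\<^sup>2 + 2 * ((l - closest_point S l) \<bullet> (v - l))) \<le> \<mu> / 2 * (infdist v S)\<^sup>2"
    using \<open>0 < \<mu>\<close> by (intro mult_left_mono power2_norm_infdist_above_tangent S) simp
  moreover have "\<mu> / 2 * (2 * ((l - closest_point S l) \<bullet> (v - l))) = l \<bullet> w - v \<bullet> w"
    by (simp add: w_def inner_diff_left inner_diff_right inner_commute algebra_simps)
  ultimately have "\<mu> / 2 * (infdist l S)\<^sup>2 + (l \<bullet> w - v \<bullet> w) \<le> \<mu> / 2 * (infdist v S)\<^sup>2"
    by (simp only: distrib_left)
  then show "- dual_function f g c l + ereal (\<mu> / 2 * (infdist l S)\<^sup>2)
      \<le> - dual_function f g c v + ereal (\<mu> / 2 * (infdist v S)\<^sup>2)"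
    using v by (cases "dual_function f g c v") (auto simp: l)
qed

text \<open>A positive limit makes the successive ratios tend to \<open>1\<close>, so eventually
  they exceed \<open>\<beta>\<close> and the only admissible factor is \<open>1\<close>.\<close>

lemma eventually_const_penalty:
  fixes mu :: "nat \<Rightarrow> real"
  assumes step: "\<And>k. \<exists>b\<in>{0<..\<beta>} \<union> {1}. mu (Suc k) = b * mu k" and "\<beta> < 1" "0 < \<mu>"
    and lim: "mu \<longlonglongrightarrow> \<mu>" and pos: "\<And>k. 0 < mu k"
  obtains K where "\<And>k. K \<le> k \<Longrightarrow> mu k = \<mu>"
proof -
  have "(\<lambda>k. mu (Suc k) / mu k) \<longlonglongrightarrow> \<mu> / \<mu>"
    using \<open>0 < \<mu>\<close> by (intro tendsto_divide lim LIMSEQ_Suc[OF lim]) simp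
  then have "(\<lambda>k. mu (Suc k) / mu k) \<longlonglongrightarrow> 1" using \<open>0 < \<mu>\<close> by simp
  from order_tendstoD(1)[OF this \<open>\<beta> < 1\<close>] obtain K where K: "\<And>k. K \<le> k \<Longrightarrow> \<beta> < mu (Suc k) / mu k"
    by (auto simp: eventually_sequentially)
  have "mu (Suc k) = mu k" if "K \<le> k" for k
  proof -
    obtain b where b: "b \<in> {0<..\<beta>} \<union> {1}" "mu (Suc k) = b * mu k" using step by blast
    then have "\<beta> < b" using K[OF that] pos[of k] by simp
    then show ?thesis using b by auto
  qed
  then have const: "mu (n + K) = mu K" for n by (induction n) simp_all
  then have "(\<lambda>n. mu (n + K)) \<longlonglongrightarrow> mu K" by simp
  with LIMSEQ_ignore_initial_segment[OF lim, of K] have "mu K = \<mu>" by (rule LIMSEQ_unique[rotated])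
  then have "mu k = \<mu>" if "K \<le> k" for k
    using const[of "k - K"] that by simp
  then show thesis by (rule that)
qed

text \<open>Since \<open>z\<close> solves the inner problem exactly,
  \<open>\<epsilon>\<close>-minimality of \<open>x\<close> becomes
  \<open>\<epsilon>\<close>-minimality of the perturbation \<open>z - c x\<close> over the whole
  closed epigraph, and \<open>inexact_epi_prox\<close> applies.\<close>

lemma safeguarded_ALM_step:
  fixes c :: "real ^ 'n \<Rightarrow> real ^ 'm"
  assumes data: "composite_data f g c gradf J" and sub: "q \<in> subdifferential g z0" and "0 < \<mu>"
    and inexact: "aug_lagrangian f g c \<mu> x v \<le> (INF x'. aug_lagrangian f g c \<mu> x' v) + ereal \<epsilon>"
    and p: "epi_subgradient (closure (value_epi f g c)) p (\<mu> *\<^sub>R (v - p)) \<rho>"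
  defines "z \<equiv> prox (\<lambda>w. ereal \<mu> * g w) (c x + \<mu> *\<^sub>R v)"
  shows "norm (v + (1 / \<mu>) *\<^sub>R (c x - z) - p) \<le> sqrt 2 * sqrt (\<epsilon> / \<mu>)"
proof -
  have g: "proper g" "lsc g" "econvex g" using data by (auto simp: composite_data_def)
  \<comment> \<open>\<open>prox_characterization\<close> wants its centre in the form
    \<open>\<mu> *\<^sub>R v\<close>.\<close>
  let ?v = "(1 / \<mu>) *\<^sub>R c x + v"
  have v: "\<mu> *\<^sub>R ?v = c x + \<mu> *\<^sub>R v" using \<open>0 < \<mu>\<close> by (simp add: scaleR_add_right)
  obtain s where s: "g z = ereal s"
    and min: "\<And>w r. g w \<le> ereal r \<Longrightarrow>
      s + (norm (z - (c x + \<mu> *\<^sub>R v)))\<^sup>2 / (2 * \<mu>) \<le> r + (norm (w - (c x + \<mu> *\<^sub>R v)))\<^sup>2 / (2 * \<mu>)"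
    using prox_characterization[OF g sub \<open>0 < \<mu>\<close>, of ?v] unfolding v z_def[symmetric] by blast
  define w where "w = z - c x"
  define r where "r = f x + s"
  have aug: "aug_lagrangian f g c \<mu> x v = ereal (r + (norm w)\<^sup>2 / (2 * \<mu>) - v \<bullet> w)"
    unfolding w_def r_def by (rule aug_lagrangian_eq[OF \<open>0 < \<mu>\<close> s g(1)]) (rule min)
  let ?Q = "\<lambda>u. snd u + (norm (fst u))\<^sup>2 / (2 * \<mu>) - v \<bullet> fst u + \<epsilon>"
  have "r + (norm w)\<^sup>2 / (2 * \<mu>) - v \<bullet> w \<le> ?Q u" if u: "u \<in> value_epi f g c" for u
  proof -
    obtain w' r' where u': "u = (w', r')" by (cases u)
    obtain x' where x': "g (c x' + w') \<le> ereal (r' - f x')" using u u' by (auto simp: value_epi_iff)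
    have "(INF x'. aug_lagrangian f g c \<mu> x' v) \<le> ereal (r' + (norm w')\<^sup>2 / (2 * \<mu>) - v \<bullet> w')"
      by (rule INF_lower2[OF UNIV_I]) (rule aug_lagrangian_le[of \<mu> g c x' w' r' f, OF \<open>0 < \<mu>\<close> x'])
    then have "(INF x'. aug_lagrangian f g c \<mu> x' v) + ereal \<epsilon>
        \<le> ereal (r' + (norm w')\<^sup>2 / (2 * \<mu>) - v \<bullet> w') + ereal \<epsilon>"
      by (intro add_right_mono)
    from order_trans[OF inexact this] show ?thesis by (simp add: aug u')
  qed
  then have "r + (norm w)\<^sup>2 / (2 * \<mu>) - v \<bullet> w \<le> ?Q u" if u: "u \<in> closure (value_epi f g c)" for u
    by (rule closure_le[OF _ _ _ u]) (use \<open>0 < \<mu>\<close> in \<open>auto intro!: continuous_intros\<close>)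
  then have approx: "r + (norm w)\<^sup>2 / (2 * \<mu>) - v \<bullet> w \<le> r' + (norm w')\<^sup>2 / (2 * \<mu>) - v \<bullet> w' + \<epsilon>"
    if "(w', r') \<in> closure (value_epi f g c)" for w' r'
    using that by fastforce
  have "(w, r) \<in> value_epi f g c"
    unfolding value_epi_iff by (rule exI[of _ x]) (simp add: w_def r_def s)
  then have "(w, r) \<in> closure (value_epi f g c)" using closure_subset by blast
  then have "norm (v - (1 / \<mu>) *\<^sub>R w - p) \<le> sqrt 2 * sqrt (\<epsilon> / \<mu>)"
    by (rule inexact_epi_prox[OF p _ \<open>0 < \<mu>\<close>]) (rule approx)
  moreover have "v - (1 / \<mu>) *\<^sub>R w = v + (1 / \<mu>) *\<^sub>R (c x - z)"
    by (simp add: w_def scaleR_diff_right)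
  ultimately show ?thesis by simp
qed

theorem theorem5p3:
  fixes f :: "real ^ 'n \<Rightarrow> real"
    and g :: "real ^ 'm \<Rightarrow> ereal"
    and c :: "real ^ 'n \<Rightarrow> real ^ 'm"
    and gradf :: "real ^ 'n \<Rightarrow> real ^ 'n"
    and J :: "real ^ 'n \<Rightarrow> real ^ 'n ^ 'm"
    and S \<Lambda> :: "(real ^ 'm) set"
    and \<beta> \<mu> :: real
    and \<epsilon> mu :: "nat \<Rightarrow> real"
    and xs :: "real ^ 'n"
    and x :: "nat \<Rightarrow> real ^ 'n"
    and z y yh :: "nat \<Rightarrow> real ^ 'm"
  assumes "composite_data f g c gradf J"
    and "\<exists>x'. is_minimizer (objective f g c) x' \<and> stationary g c gradf J x'"
    and "is_minimizer (objective f g c) xs"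
    and "\<Lambda> = multipliers g c gradf J xs"
    and "safeguarded_ALM f g c S \<beta> \<epsilon> mu x z y yh"
    and "summable (\<lambda>k. sqrt (\<epsilon> k / mu k))"
    and "mu \<longlonglongrightarrow> \<mu>"
  shows "bounded (range y) \<and>
         (\<mu> = 0 \<longrightarrow> (\<forall>l. (\<exists>r. strict_mono r \<and> (y \<circ> r) \<longlonglongrightarrow> l) \<longrightarrow> l \<in> \<Lambda>)) \<and>
         (\<mu> > 0 \<longrightarrow>
           (\<exists>l. y \<longlonglongrightarrow> l \<and>
                is_minimizer (\<lambda>v. - dual_function f g c v + ereal (\<mu> / 2 * (infdist v S)\<^sup>2)) l)) \<and>
         (\<Lambda> \<inter> S \<noteq> {} \<longrightarrow> (\<exists>l\<in>\<Lambda> \<inter> S. y \<longlonglongrightarrow> l))"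
proof -
  note data = \<open>composite_data f g c gradf J\<close> and lim = \<open>mu \<longlonglongrightarrow> \<mu>\<close>
  have g: "proper g" and convex_E: "convex (value_epi f g c)"
    using data by (auto simp: composite_data_def intro!: convex_value_epi)
  define C where "C = closure (value_epi f g c)"
  have C: "closed C" "convex C" by (simp_all add: C_def convex_closure convex_E)
  obtain x' where x': "is_minimizer (objective f g c) x'" "multipliers g c gradf J x' \<noteq> {}"
    using assms(2) by (auto simp: stationary_def)
  have feasible: "g (c u) < \<infinity>" if "is_minimizer (objective f g c) u" for u
    using that by (cases "g (c u)") (auto simp: is_minimizer_def edom_def objective_def)
  obtain s where s: "g (c xs) = ereal s" using properD[OF g feasible[OF assms(3)]] .
  obtain s' where s': "g (c x') = ereal s'" using properD[OF g feasible[OF x'(1)]] .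
  define a where "a = f xs + s"
  have "objective f g c xs = objective f g c x'"
    using assms(3) x'(1) by (intro antisym) (simp_all add: is_minimizer_def)
  then have a: "f x' + s' = a" by (simp add: objective_def s s' a_def)
  have "(0, a) \<in> value_epi f g c"
    unfolding value_epi_iff by (rule exI[of _ xs]) (simp add: s a_def)
  then have aC: "(0, a) \<in> C" unfolding C_def using closure_subset by blast
  \<comment> \<open>Stated for any point \<open>u\<close> of optimal value \<open>a\<close>, so that
    it covers both \<open>xs\<close> and the stationary minimizer \<open>x'\<close>; a multiplier of
    \<open>x'\<close> thus serves as \<open>q\<close>.\<close>
  have \<Lambda>: "p \<in> multipliers g c gradf J u \<longleftrightarrow> epi_subgradient C p 0 a"
    if "g (c u) = ereal t" "f u + t = a" for p u t
  proof
    assume "p \<in> multipliers g c gradf J u"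
    then have le: "\<forall>(w, r)\<in>value_epi f g c. a + p \<bullet> w \<le> r"
      using multipliers_iff[OF data that(1)] that(2) by simp
    have "a + p \<bullet> fst v \<le> snd v" if v: "v \<in> closure (value_epi f g c)" for v
      by (rule closure_le[OF _ _ _ v]) (use le in \<open>auto intro!: continuous_intros\<close>)
    then have "\<forall>(w, r)\<in>C. a + p \<bullet> (w - 0) \<le> r" unfolding C_def by fastforce
    then show "epi_subgradient C p 0 a" using aC unfolding epi_subgradient_def by blast
  next
    assume p: "epi_subgradient C p 0 a"
    have "a + p \<bullet> w \<le> r" if "(w, r) \<in> value_epi f g c" for w r
    proof -
      have "(w, r) \<in> C" unfolding C_def using that closure_subset by blast
      from epi_subgradientD[OF p this] show ?thesis by simp
    qed
    then show "p \<in> multipliers g c gradf J u"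
      using multipliers_iff[OF data that(1)] that(2) by auto
  qed
  have \<Lambda>_iff: "p \<in> \<Lambda> \<longleftrightarrow> epi_subgradient C p 0 a" for p
    unfolding assms(4) by (rule \<Lambda>[OF s]) (simp add: a_def)
  obtain q where q: "q \<in> multipliers g c gradf J x'" using x'(2) by blast
  then have qC: "epi_subgradient C q 0 a" by (simp add: \<Lambda>[OF s' a])
  have q_sub: "q \<in> subdifferential g (c x')" using q by (simp add: multipliers_def)
  have S: "S \<noteq> {}" "convex S" "compact S" and "\<beta> < 1" and mu0: "0 < mu 0"
    and yh: "\<And>k. yh k = closest_point S (y k)"
    and inexact: "\<And>k. aug_lagrangian f g c (mu k) (x k) (yh k)
            \<le> (INF x'. aug_lagrangian f g c (mu k) x' (yh k)) + ereal (\<epsilon> k)"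
    and z: "\<And>k. z k = prox (\<lambda>w. ereal (mu k) * g w) (c (x k) + mu k *\<^sub>R yh k)"
    and y: "\<And>k. y (Suc k) = yh k + (1 / mu k) *\<^sub>R (c (x k) - z k)"
    and step: "\<And>k. \<exists>b \<in> {0<..\<beta>} \<union> {1}. mu (Suc k) = b * mu k"
    using assms(5) unfolding safeguarded_ALM_def by blast+
  have mu_pos: "0 < mu k" for k
  proof (induction k)
    case (Suc k)
    obtain b where "b \<in> {0<..\<beta>} \<union> {1}" "mu (Suc k) = b * mu k" using step by blast
    with Suc show ?case by auto
  qed (rule mu0)
  have "C \<noteq> {}" using aC by blast
  \<comment> \<open>The multiplier \<open>q\<close> provides the affine minorant on which existence
    of the exact proximal steps rests.\<close>
  have minorant: "a + q \<bullet> w \<le> r" if "(w, r) \<in> C" for w r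
    using epi_subgradientD[OF qC that] by simp
  have "\<exists>p \<rho>. epi_subgradient C p (mu k *\<^sub>R (yh k - p)) \<rho>" for k
    by (rule epi_prox_exists[OF C \<open>C \<noteq> {}\<close> minorant mu_pos])
  then obtain p \<rho> where p: "\<And>k. epi_subgradient C (p k) (mu k *\<^sub>R (yh k - p k)) (\<rho> k)" by metis
  interpret safeguarded_prox C a S mu "\<lambda>k. sqrt 2 * sqrt (\<epsilon> k / mu k)" \<rho> y p q
  proof unfold_locales
    fix k
    show "epi_subgradient C (p k) (mu k *\<^sub>R (closest_point S (y k) - p k)) (\<rho> k)"
      using p[of k] by (simp only: yh)
    show "norm (y (Suc k) - p k) \<le> sqrt 2 * sqrt (\<epsilon> k / mu k)"
      unfolding y z using safeguarded_ALM_step[OF data q_sub mu_pos inexact] p[of k]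
      unfolding C_def by blast
  qed (use C S qC mu_pos assms(6) in \<open>auto intro: summable_mult\<close>)
  show ?thesis
  proof (intro conjI impI allI; (elim exE conjE)?)
    show "bounded (range y)" by (rule bounded_y)
  next
    fix l r assume "\<mu> = 0" and r: "strict_mono r" "(y \<circ> r) \<longlonglongrightarrow> l"
    \<comment> \<open>The residual is a null sequence times a bounded one, hence tends to
      \<open>0\<close>.\<close>
    have "bounded (range (\<lambda>k. closest_point S (y k) - p k))"
      by (rule bounded_minus_comp[OF bounded_proj bounded_p])
    then have "Bseq (\<lambda>k. closest_point S (y k) - p k)" by (simp only: Bseq_eq_bounded)
    moreover have "Zfun mu sequentially" using lim \<open>\<mu> = 0\<close> by (simp add: tendsto_Zfun_iff)
    ultimately have "Zfun (\<lambda>k. mu k *\<^sub>R (closest_point S (y k) - p k)) sequentially"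
      by (intro bounded_bilinear.Zfun_prod_Bfun[OF bounded_bilinear_scaleR])
    then have "(\<lambda>k. mu k *\<^sub>R (closest_point S (y k) - p k)) \<longlonglongrightarrow> 0" by (simp add: tendsto_Zfun_iff)
    from accumulation_multiplier[OF this r] show "l \<in> \<Lambda>" by (simp only: \<Lambda>_iff)
  next
    assume "0 < \<mu>"
    obtain K where "\<And>k. K \<le> k \<Longrightarrow> mu k = \<mu>"
      using eventually_const_penalty[OF step \<open>\<beta> < 1\<close> \<open>0 < \<mu>\<close> lim mu_pos] by blast
    then obtain l b where "y \<longlonglongrightarrow> l" and l: "epi_subgradient C l (\<mu> *\<^sub>R (closest_point S l - l)) b"
      using tendsto_fixed_point[of K \<mu>] \<open>0 < \<mu>\<close> by blast
    moreover have "is_minimizer (\<lambda>v. - dual_function f g c v + ereal (\<mu> / 2 * (infdist v S)\<^sup>2)) l"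
      by (rule fixed_point_minimizes_dual[OF g S(2) closed_S S(1) \<open>0 < \<mu>\<close> l[unfolded C_def]])
    ultimately show "\<exists>l. y \<longlonglongrightarrow> l \<and>
        is_minimizer (\<lambda>v. - dual_function f g c v + ereal (\<mu> / 2 * (infdist v S)\<^sup>2)) l" by blast
  next
    assume "\<Lambda> \<inter> S \<noteq> {}"
    then obtain u where "u \<in> S" "epi_subgradient C u 0 a" by (auto simp: \<Lambda>_iff)
    from tendsto_multiplier[OF lim this] show "\<exists>l\<in>\<Lambda> \<inter> S. y \<longlonglongrightarrow> l" by (auto simp: \<Lambda>_iff)
  qed
qed

end
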